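(* Let $\Omega=[-1,1]^2$ and $$X_2=\{u:\Omega\to\mathbb{R}\ :\ u\in H^2(\Omega),\ \partial_\nu u|_{\partial\Omega}=0\}.$$ For $u\in X_2$ define $$R_2[u]=\frac{1}{2|\Omega|}\int_\Omega |\Delta u|^2\,dx,\qquad R_3[u]=\frac{1}{2|\Omega|}\int_\Omega |\mathrm{H}u|_F^2\,dx .$$ Then $R_2[u]=R_3[u]$ for every $u\in X_2$.
   Context: $H^2(\Omega)$ is the Sobolev space of $L^2$-functions with first and second order weak derivatives in $L^2(\Omega)$; $\partial_\nu u$ is the derivative in the direction of the exterior unit normal on $\partial\Omega$ (the boundary condition is understood in the sense of traces); $\Delta u$ is the Laplacian, $\mathrm{H}u$ the $2\times2$ Hessian matrix of $u$, $|\cdot|_F$ the Frobenius norm, and $|\Omega|=4$ the area of $\Omega$. *)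

theory Defs
  imports "HOL-Analysis.Analysis"
begin

section \<open>Smooth functions and test functions\<close>

definition partial_deriv :: "'n::finite \<Rightarrow> (real^'n \<Rightarrow> real) \<Rightarrow> real^'n \<Rightarrow> real" where
  "partial_deriv i f x = frechet_derivative f (at x) (axis i 1)"

definition smooth :: "(real^'n::finite \<Rightarrow> real) \<Rightarrow> bool" where
  "smooth f \<longleftrightarrow> (\<forall>js. \<forall>x. foldr partial_deriv js f differentiable at x)"

definition test_functions :: "(real^'n::finite) set \<Rightarrow> (real^'n \<Rightarrow> real) set" where
  "test_functions U = {\<phi>. smooth \<phi> \<and> compact (closure {x. \<phi> x \<noteq> 0}) \<and> closure {x. \<phi> x \<noteq> 0} \<subseteq> U}"


section \<open>Sobolev spaces\<close>

text \<open>
  Elements of function spaces are represented by everywhere defined functions; everything below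
  depends only on the class of such a function modulo equality almost everywhere on \<open>\<Omega>\<close>.
  The set \<open>\<Omega>\<close> may be closed (as the square is): test functions live on its interior.
\<close>

definition L2 :: "'a measure \<Rightarrow> ('a \<Rightarrow> real) set" where
  "L2 M = {f \<in> borel_measurable M. integrable M (\<lambda>x. (f x)\<^sup>2)}"

definition tendsto_L2 :: "'a measure \<Rightarrow> (nat \<Rightarrow> 'a \<Rightarrow> real) \<Rightarrow> ('a \<Rightarrow> real) \<Rightarrow> bool" where
  "tendsto_L2 M f g \<longleftrightarrow> (\<forall>n. f n \<in> L2 M) \<and> g \<in> L2 M \<and>
     (\<lambda>n. \<integral>x. (f n x - g x)\<^sup>2 \<partial>M) \<longlonglongrightarrow> 0"

definition locally_integrable :: "(real^'n::finite) set \<Rightarrow> (real^'n \<Rightarrow> real) \<Rightarrow> bool" where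
  "locally_integrable U f \<longleftrightarrow> (\<forall>K. compact K \<and> K \<subseteq> U \<longrightarrow> integrable (lebesgue_on K) f)"

definition has_weak_partial ::
    "(real^'n::finite) set \<Rightarrow> 'n \<Rightarrow> (real^'n \<Rightarrow> real) \<Rightarrow> (real^'n \<Rightarrow> real) \<Rightarrow> bool" where
  "has_weak_partial \<Omega> i u g \<longleftrightarrow>
     locally_integrable (interior \<Omega>) u \<and> locally_integrable (interior \<Omega>) g \<and>
     (\<forall>\<phi>\<in>test_functions (interior \<Omega>).
        (\<integral>x. u x * partial_deriv i \<phi> x \<partial>lebesgue_on (interior \<Omega>)) =
        - (\<integral>x. g x * \<phi> x \<partial>lebesgue_on (interior \<Omega>)))"

text \<open>Weak partial derivatives are unique up to null sets; an arbitrary representative is chosen.\<close>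

definition weak_partial ::
    "(real^'n::finite) set \<Rightarrow> 'n \<Rightarrow> (real^'n \<Rightarrow> real) \<Rightarrow> real^'n \<Rightarrow> real" where
  "weak_partial \<Omega> i u = (SOME g. has_weak_partial \<Omega> i u g)"

text \<open>\<open>sobolev k \<Omega>\<close> is $H^k(\Omega)$: all iterated weak partial derivatives up to order
  \<open>k\<close> exist and are in $L^2(\Omega)$.\<close>

primrec sobolev :: "nat \<Rightarrow> (real^'n::finite) set \<Rightarrow> (real^'n \<Rightarrow> real) set" where
  "sobolev 0 \<Omega> = L2 (lebesgue_on \<Omega>)"
| "sobolev (Suc k) \<Omega> =
     {u \<in> L2 (lebesgue_on \<Omega>). \<forall>i. \<exists>g \<in> sobolev k \<Omega>. has_weak_partial \<Omega> i u g}"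

definition laplacian :: "(real^'n::finite) set \<Rightarrow> (real^'n \<Rightarrow> real) \<Rightarrow> real^'n \<Rightarrow> real" where
  "laplacian \<Omega> u x = (\<Sum>i\<in>UNIV. weak_partial \<Omega> i (weak_partial \<Omega> i u) x)"

definition hessian :: "(real^'n::finite) set \<Rightarrow> (real^'n \<Rightarrow> real) \<Rightarrow> real^'n \<Rightarrow> real^'n^'n" where
  "hessian \<Omega> u x = (\<chi> i j. weak_partial \<Omega> j (weak_partial \<Omega> i u) x)"


section \<open>Traces\<close>

text \<open>
  \<open>has_trace \<Omega> \<sigma> u g\<close>: the function \<open>g\<close> in $L^2(\partial\Omega,\sigma)$ is the trace of \<open>u\<close> in
  $H^1(\Omega)$. The trace operator is the continuous extension to $H^1(\Omega)$ of the restriction map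
  $\phi \mapsto \phi|_{\partial\Omega}$ on functions that are smooth up to the boundary, so its
  values are the limits in $L^2(\partial\Omega,\sigma)$ along sequences that converge to \<open>u\<close> in
  $H^1(\Omega)$. Here \<open>\<sigma>\<close> is the surface measure of the boundary.
\<close>

definition has_trace ::
    "(real^'n::finite) set \<Rightarrow> (real^'n) measure \<Rightarrow> (real^'n \<Rightarrow> real) \<Rightarrow> (real^'n \<Rightarrow> real) \<Rightarrow> bool"
  where
  "has_trace \<Omega> \<sigma> u g \<longleftrightarrow> u \<in> sobolev 1 \<Omega> \<and>
     (\<exists>\<phi>. (\<forall>n. smooth (\<phi> n)) \<and>
          tendsto_L2 (lebesgue_on \<Omega>) \<phi> u \<and>
          (\<forall>i. tendsto_L2 (lebesgue_on \<Omega>) (\<lambda>n. partial_deriv i (\<phi> n)) (weak_partial \<Omega> i u)) \<and>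
          tendsto_L2 \<sigma> \<phi> g)"

definition has_normal_derivative ::
    "(real^'n::finite) set \<Rightarrow> (real^'n) measure \<Rightarrow> (real^'n \<Rightarrow> real^'n) \<Rightarrow>
     (real^'n \<Rightarrow> real) \<Rightarrow> (real^'n \<Rightarrow> real) \<Rightarrow> bool" where
  "has_normal_derivative \<Omega> \<sigma> \<nu> u g \<longleftrightarrow>
     (\<exists>t. (\<forall>i. has_trace \<Omega> \<sigma> (weak_partial \<Omega> i u) (t i)) \<and>
          (AE x in \<sigma>. (\<Sum>i\<in>UNIV. \<nu> x $ i * t i x) = g x))"


section \<open>The square\<close>

definition square :: "(real^2) set" where
  "square = cbox (-1) 1"

text \<open>The side labelled \<open>(i, s)\<close> with \<open>s = \<plusminus>1\<close> is the one on which the \<open>i\<close>-th coordinate is \<open>s\<close>;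
  the other coordinate, \<open>t\<close>, is its arc length parameter.\<close>

definition side_point :: "(2 \<times> real) \<times> real \<Rightarrow> real^2" where
  "side_point = (\<lambda>((i, s), t). \<chi> j. if j = i then s else t)"

text \<open>Arc length measure on the boundary of the square.\<close>

definition square_boundary_measure :: "(real^2) measure" where
  "square_boundary_measure =
     distr (count_space (UNIV \<times> {-1, 1}) \<Otimes>\<^sub>M restrict_space lborel {-1..1}) borel side_point"

text \<open>The exterior unit normal, except at the four corners (a null set for the arc length).\<close>

definition square_normal :: "real^2 \<Rightarrow> real^2" where
  "square_normal x = (\<chi> i. if x $ i = 1 then 1 else if x $ i = -1 then -1 else 0)"

definition X2 :: "(real^2 \<Rightarrow> real) set" where
  "X2 = {u \<in> sobolev 2 square.
           has_normal_derivative square square_boundary_measure square_normal u (\<lambda>_. 0)}"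

definition R2 :: "(real^2 \<Rightarrow> real) \<Rightarrow> real" where
  "R2 u = 1 / (2 * measure lebesgue square) *
     (\<integral>x. \<bar>laplacian square u x\<bar>\<^sup>2 \<partial>lebesgue_on square)"

text \<open>The library norm on \<^typ>\<open>real^2^2\<close> is the Euclidean norm of the entries, i.e. the
  Frobenius norm.\<close>

definition R3 :: "(real^2 \<Rightarrow> real) \<Rightarrow> real" where
  "R3 u = 1 / (2 * measure lebesgue square) *
     (\<integral>x. (norm (hessian square u x))\<^sup>2 \<partial>lebesgue_on square)"

end

theory Submission
  imports Defs
begin

text \<open>
  Let \<open>p = \<partial>\<^sub>1 u\<close> and \<open>q = \<partial>\<^sub>2 u\<close>. Since weak second derivatives commute, the
  integrands differ by
  \<open>2 (\<partial>\<^sub>1 p \<partial>\<^sub>2 q - \<partial>\<^sub>2 p \<partial>\<^sub>1 q)\<close>, twice a Jacobian determinant, which for smooth functions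
  integrates to a boundary term. The trace of \<open>p\<close> vanishes on the vertical sides and that of
  \<open>q\<close> on the horizontal ones. Smooth approximations of \<open>q\<close> are multiplied by a cutoff in the
  second variable, so that only the vertical sides contribute to the boundary term, and there the
  approximations of \<open>p\<close> tend to \<open>0\<close>. The error caused by the cutoff is controlled by a
  Hardy type estimate, which uses that the trace of \<open>q\<close> vanishes on the horizontal sides.
\<close>

section \<open>Smooth functions\<close>

text \<open>The boundary term pairs values of the approximations of \<open>p\<close> with tangential
  derivatives of those of \<open>q\<close>, and the latter need not stay bounded on the boundary.
  Hence the limits are taken one at a time: \<open>p\<close> first, against a fixed smooth function,
  then \<open>q\<close>, and only then the cutoff parameter \<open>N\<close>. The cutoff has a
  price, the integral of \<open>a\<close> times \<open>cutoff_deriv\<close> times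
  \<open>\<psi>\<close>. A function vanishing at an endpoint is bounded by the square root of the
  distance times the norm of its derivative, so the price is governed by the integral of
  \<open>(cutoff_deriv N t)\<^sup>2 * (1 - \<bar>t\<bar>)\<close>. A piecewise linear cutoff on
  layers of width eps has slope 1/eps there, and this integral equals 1 for every eps. The first
  \<open>N\<close> terms of the series of \<open>- ln (1 - t\<^sup>2)\<close>, divided by their
  value \<open>harm N\<close> at the endpoints, give instead a polynomial cutoff for which the
  integral is at most \<open>8 / harm N\<close>.\<close>

lemma partial_deriv_eqI:
  assumes "(f has_derivative f') (at x)"
  shows "partial_deriv i f x = f' (axis i 1)"
  unfolding partial_deriv_def using frechet_derivative_at[OF assms] by simp

lemma smooth_differentiable: "smooth f \<Longrightarrow> f differentiable (at x)"
  unfolding smooth_def by (drule spec[of _ "[]"]) simp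

lemma smooth_partial_deriv: "smooth f \<Longrightarrow> smooth (partial_deriv i f)"
  unfolding smooth_def
proof (intro allI)
  fix js x assume "\<forall>js x. foldr partial_deriv js f differentiable at x"
  then have "foldr partial_deriv (js @ [i]) f differentiable at x" by blast
  then show "foldr partial_deriv js (partial_deriv i f) differentiable at x" by simp
qed

lemma smooth_continuous_on: "smooth f \<Longrightarrow> continuous_on S f"
  by (meson smooth_differentiable continuous_at_imp_continuous_on differentiable_imp_continuous_within)

lemma smooth_has_derivative:
  assumes "smooth f"
  shows "(f has_derivative (\<lambda>h. \<Sum>i\<in>UNIV. h $ i * partial_deriv i f x)) (at x)"
proof -
  let ?f' = "frechet_derivative f (at x)"
  have d: "(f has_derivative ?f') (at x)"
    using smooth_differentiable[OF assms] frechet_derivative_works by blast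
  have lin: "linear ?f'" using d has_derivative_linear by blast
  have "?f' h = (\<Sum>i\<in>UNIV. h $ i * partial_deriv i f x)" for h
  proof -
    have "?f' h = ?f' (\<Sum>i\<in>UNIV. h $ i *s axis i 1)" by (simp add: basis_expansion)
    also have "\<dots> = (\<Sum>i\<in>UNIV. h $ i * partial_deriv i f x)"
      by (simp add: linear_sum[OF lin] linear_scale[OF lin] partial_deriv_def scalar_mult_eq_scaleR)
    finally show ?thesis .
  qed
  with d show ?thesis by (simp add: fun_eq_iff has_derivative_eq_rhs)
qed

lemma smooth_partial_deriv_along:
  assumes "smooth f"
  shows "((\<lambda>s. f (x + s *\<^sub>R axis i 1)) has_real_derivative partial_deriv i f (x + s *\<^sub>R axis i 1)) (at s)"
proof -
  have "((\<lambda>s. f (x + s *\<^sub>R axis i 1)) has_derivative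
         (\<lambda>h. \<Sum>j\<in>UNIV. (h *\<^sub>R axis i 1) $ j * partial_deriv j f (x + s *\<^sub>R axis i 1))) (at s)"
    by (rule has_derivative_compose[OF _ smooth_has_derivative[OF assms]])
       (auto intro!: derivative_eq_intros)
  moreover have "(\<Sum>j\<in>UNIV. (h *\<^sub>R axis i 1) $ j * partial_deriv j f y) = partial_deriv i f y * h"
    for h y
    by (simp add: axis_def if_distrib if_distribR cong: if_cong)
  ultimately show ?thesis by (simp add: has_field_derivative_def)
qed

lemma smooth_partial_deriv_commute:
  assumes f: "smooth f"
  shows "partial_deriv i (partial_deriv j f) x = partial_deriv j (partial_deriv i f) x"
proof -
  define \<Delta> where "\<Delta> h = f (x + h *\<^sub>R axis i 1 + h *\<^sub>R axis j 1) - f (x + h *\<^sub>R axis i 1)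
    - f (x + h *\<^sub>R axis j 1) + f x" for h
  have \<Delta>_eq: "\<Delta> h = f (x + h *\<^sub>R axis j 1 + h *\<^sub>R axis i 1) - f (x + h *\<^sub>R axis j 1)
    - f (x + h *\<^sub>R axis i 1) + f x" for h
    by (simp add: \<Delta>_def algebra_simps)
  \<comment> \<open>The second difference is symmetric in the two directions, and each order of applying the
    mean value theorem turns it into one of the two mixed derivatives.\<close>
  have mvt: "\<exists>s t. 0 < s \<and> s < h \<and> 0 < t \<and> t < h \<and>
      f (x + h *\<^sub>R axis k 1 + h *\<^sub>R axis l 1) - f (x + h *\<^sub>R axis k 1) - f (x + h *\<^sub>R axis l 1) + f x
      = h^2 * partial_deriv l (partial_deriv k f) (x + s *\<^sub>R axis k 1 + t *\<^sub>R axis l 1)"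
    if h: "0 < h" for h k l
  proof -
    have "\<exists>s. 0 < s \<and> s < h \<and>
      (f (x + h *\<^sub>R axis l 1 + h *\<^sub>R axis k 1) - f (x + h *\<^sub>R axis k 1)) -
      (f (x + h *\<^sub>R axis l 1 + 0 *\<^sub>R axis k 1) - f (x + 0 *\<^sub>R axis k 1))
      = (h - 0) * (partial_deriv k f (x + h *\<^sub>R axis l 1 + s *\<^sub>R axis k 1) - partial_deriv k f (x + s *\<^sub>R axis k 1))"
      by (rule MVT2[OF h]) (intro DERIV_diff smooth_partial_deriv_along f)
    then obtain s where s: "0 < s" "s < h" and 1:
      "(f (x + h *\<^sub>R axis l 1 + h *\<^sub>R axis k 1) - f (x + h *\<^sub>R axis k 1)) - (f (x + h *\<^sub>R axis l 1) - f x)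
      = h * (partial_deriv k f (x + h *\<^sub>R axis l 1 + s *\<^sub>R axis k 1) - partial_deriv k f (x + s *\<^sub>R axis k 1))"
      by auto
    have "\<exists>t. 0 < t \<and> t < h \<and>
      partial_deriv k f (x + s *\<^sub>R axis k 1 + h *\<^sub>R axis l 1) - partial_deriv k f (x + s *\<^sub>R axis k 1 + 0 *\<^sub>R axis l 1)
      = (h - 0) * partial_deriv l (partial_deriv k f) (x + s *\<^sub>R axis k 1 + t *\<^sub>R axis l 1)"
      by (rule MVT2[OF h]) (intro smooth_partial_deriv_along smooth_partial_deriv f)
    then obtain t where "0 < t" "t < h" and
      "partial_deriv k f (x + s *\<^sub>R axis k 1 + h *\<^sub>R axis l 1) - partial_deriv k f (x + s *\<^sub>R axis k 1)
      = h * partial_deriv l (partial_deriv k f) (x + s *\<^sub>R axis k 1 + t *\<^sub>R axis l 1)"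
      by auto
    with s 1 show ?thesis
      by (intro exI[of _ s] exI[of _ t]) (simp add: algebra_simps power2_eq_square)
  qed
  have lim: "(\<lambda>n. real (Suc n)^2 * \<Delta> (1 / real (Suc n))) \<longlonglongrightarrow> partial_deriv l (partial_deriv k f) x"
    if kl: "(k = i \<and> l = j) \<or> (k = j \<and> l = i)" for k l
  proof -
    have "\<forall>n. \<exists>s t. 0 < s \<and> s < 1 / real (Suc n) \<and> 0 < t \<and> t < 1 / real (Suc n) \<and>
      \<Delta> (1 / real (Suc n)) = (1 / real (Suc n))^2 * partial_deriv l (partial_deriv k f) (x + s *\<^sub>R axis k 1 + t *\<^sub>R axis l 1)"
    proof
      fix n
      show "\<exists>s t. 0 < s \<and> s < 1 / real (Suc n) \<and> 0 < t \<and> t < 1 / real (Suc n) \<and>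
      \<Delta> (1 / real (Suc n)) = (1 / real (Suc n))^2 * partial_deriv l (partial_deriv k f) (x + s *\<^sub>R axis k 1 + t *\<^sub>R axis l 1)"
        using mvt[of "1 / real (Suc n)" k l] kl
          \<Delta>_def[of "1 / real (Suc n)"] \<Delta>_eq[of "1 / real (Suc n)"]
        by (elim disjE conjE) (simp_all only: of_nat_0_less_iff zero_less_Suc zero_less_divide_1_iff simp_thms)
    qed
    then obtain s t where s: "\<And>n. 0 < s n \<and> s n < 1 / real (Suc n)" and t: "\<And>n. 0 < t n \<and> t n < 1 / real (Suc n)"
      and eq: "\<And>n. \<Delta> (1 / real (Suc n)) = (1 / real (Suc n))^2 * partial_deriv l (partial_deriv k f) (x + s n *\<^sub>R axis k 1 + t n *\<^sub>R axis l 1)"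
      by metis
    have z: "(\<lambda>n. 1 / real (Suc n)) \<longlonglongrightarrow> 0" using lim_1_over_n LIMSEQ_Suc by blast
    have "s \<longlonglongrightarrow> 0"
      by (rule tendsto_sandwich[OF _ _ tendsto_const z]) (use s less_imp_le in \<open>auto intro!: always_eventually\<close>)
    moreover have "t \<longlonglongrightarrow> 0"
      by (rule tendsto_sandwich[OF _ _ tendsto_const z]) (use t less_imp_le in \<open>auto intro!: always_eventually\<close>)
    ultimately have "(\<lambda>n. x + s n *\<^sub>R axis k 1 + t n *\<^sub>R axis l 1) \<longlonglongrightarrow> x + 0 *\<^sub>R axis k 1 + 0 *\<^sub>R axis l 1"
      by (intro tendsto_intros)
    then have 2: "(\<lambda>n. x + s n *\<^sub>R axis k 1 + t n *\<^sub>R axis l 1) \<longlonglongrightarrow> x" by simp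
    \<comment> \<open>\<open>smooth\<close> makes the mixed derivative itself differentiable, hence
      continuous, so its values at the mean value points converge to the value at
      \<open>x\<close>.\<close>
    have "isCont (partial_deriv l (partial_deriv k f)) x"
      using smooth_differentiable[of "partial_deriv l (partial_deriv k f)"] smooth_partial_deriv f
        differentiable_imp_continuous_within by blast
    from isCont_tendsto_compose[OF this 2]
    show ?thesis by (simp add: eq power_divide del: of_nat_Suc)
  qed
  show ?thesis
    using LIMSEQ_unique[OF lim[of i j] lim[of j i]] by simp
qed

text \<open>Up to the negative powers produced by differentiation, this is the usual flat function
  \<open>exp (- 1 / t)\<close>; the family is closed under differentiation.\<close>

definition flat :: "nat \<Rightarrow> real \<Rightarrow> real" where
  "flat m t = (if t > 0 then exp (- 1 / t) / t ^ m else 0)"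

text \<open>From the right, the substitution \<open>x = 1 / t\<close> turns this into the limit of
  \<open>x ^ m / exp x\<close> at infinity.\<close>

lemma flat_tendsto_0: "(flat m \<longlongrightarrow> 0) (at 0)"
proof -
  have "((\<lambda>x::real. x ^ m / exp x) \<longlongrightarrow> 0) at_top" by (rule tendsto_power_div_exp_0)
  then have "((\<lambda>t::real. inverse t ^ m / exp (inverse t)) \<longlongrightarrow> 0) (at_right 0)"
    by (rule filterlim_compose[OF _ filterlim_inverse_at_top_right])
  moreover have "\<forall>\<^sub>F t in at_right 0. inverse t ^ m / exp (inverse t) = flat m t"
    by (auto simp: eventually_at_right_field flat_def exp_minus field_simps intro!: exI[of _ 1])
  ultimately have "(flat m \<longlongrightarrow> 0) (at_right 0)" using tendsto_cong by fastforce
  moreover have "(flat m \<longlongrightarrow> 0) (at_left 0)"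
    by (rule tendsto_eventually) (auto simp: eventually_at_left_field flat_def intro!: exI[of _ "-1"])
  ultimately show ?thesis using filterlim_split_at by blast
qed

lemma flat_has_derivative:
  "(flat m has_real_derivative (flat (m + 2) t - real m * flat (m + 1) t)) (at t)"
proof (cases t "0::real" rule: linorder_cases)
  case less
  have "(flat m has_real_derivative 0) (at t)"
    by (rule has_field_derivative_transform_within_open[OF DERIV_const open_lessThan[of 0]])
       (use less in \<open>auto simp: flat_def\<close>)
  with less show ?thesis by (simp add: flat_def)
next
  case equal
  \<comment> \<open>The difference quotient of \<open>flat m\<close> at 0 is
    \<open>flat (m + 1)\<close>: dividing by \<open>t\<close> raises the index by one.\<close>
  have "((\<lambda>y. (flat m y - flat m 0) / (y - 0)) \<longlongrightarrow> 0) (at 0)"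
    using flat_tendsto_0[of "m + 1"]
    by (rule Lim_transform_eventually) (auto simp: eventually_at flat_def intro!: exI[of _ 1])
  then show ?thesis using equal
    by (simp add: has_field_derivative_iff flat_def)
next
  case greater
  have "((\<lambda>t. exp (- 1 / t) / t ^ m) has_real_derivative
     exp (- 1 / t) / t ^ (m + 2) - real m * (exp (- 1 / t) / t ^ (m + 1))) (at t)"
    using greater by (auto intro!: derivative_eq_intros simp: field_simps power2_eq_square)
       (cases m; simp add: field_simps)
  then have "(flat m has_real_derivative exp (- 1 / t) / t ^ (m + 2) - real m * (exp (- 1 / t) / t ^ (m + 1))) (at t)"
    by (rule has_field_derivative_transform_within_open[OF _ open_greaterThan[of 0]])
       (use greater in \<open>auto simp: flat_def\<close>)
  with greater show ?thesis by (simp add: flat_def)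
qed

text \<open>A direct induction on the list of directions in \<open>smooth\<close> breaks down for
  products, whose derivatives are sums of products. This class is closed under sums, products and
  \<open>partial_deriv\<close>, and its members are differentiable, so all of them are smooth. As
  \<open>base\<close> admits every smooth function, the closure properties of \<open>smooth\<close>
  follow.\<close>

inductive smooth_expr :: "(real^'n::finite \<Rightarrow> real) \<Rightarrow> bool" where
  base: "smooth f \<Longrightarrow> smooth_expr f"
| const: "smooth_expr (\<lambda>_. c)"
| coord: "smooth_expr (\<lambda>x. x $ i)"
| flat: "smooth_expr (\<lambda>x. flat m (\<alpha> + \<beta> * x $ i))"
| add: "smooth_expr f \<Longrightarrow> smooth_expr g \<Longrightarrow> smooth_expr (\<lambda>x. f x + g x)"
| mult: "smooth_expr f \<Longrightarrow> smooth_expr g \<Longrightarrow> smooth_expr (\<lambda>x. f x * g x)"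

lemma has_derivative_nth: "((\<lambda>x. x $ i) has_derivative (\<lambda>h. h $ i)) F"
  by (rule bounded_linear.has_derivative[OF bounded_linear_vec_nth has_derivative_ident])

lemma has_derivative_comp_coord:
  fixes x :: "real^'n"
  assumes "(c has_real_derivative c') (at (x $ i))"
  shows "((\<lambda>x. c (x $ i)) has_derivative (\<lambda>h. c' * h $ i)) (at x)"
  using has_derivative_compose[OF has_derivative_nth[of i "at x"], of c "(*) c'"] assms
  by (simp add: has_field_derivative_def)

lemma smooth_expr_differentiable:
  "smooth_expr f \<Longrightarrow> (\<forall>x. f differentiable (at x)) \<and> (\<forall>i. smooth_expr (partial_deriv i f))"
proof (induction rule: smooth_expr.induct)
  case (base f)
  then show ?case using smooth_differentiable smooth_partial_deriv smooth_expr.base by blast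
next
  case (const c)
  have "partial_deriv i (\<lambda>_. c) = (\<lambda>_. 0)" for i :: 'a
    by (simp add: fun_eq_iff partial_deriv_eqI[OF has_derivative_const])
  then show ?case by (simp add: smooth_expr.const)
next
  case (coord i)
  have "partial_deriv j (\<lambda>x. x $ i) = (\<lambda>_. axis j 1 $ i)" for j
    by (simp add: fun_eq_iff partial_deriv_eqI[OF has_derivative_nth])
  then show ?case
    using differentiableI[OF has_derivative_nth] by (metis smooth_expr.const)
next
  case (flat m \<alpha> \<beta> i)
  let ?F = "\<lambda>m x. flat m (\<alpha> + \<beta> * x $ i)"
  have "((\<lambda>t. flat m (\<alpha> + \<beta> * t)) has_real_derivative
     (flat (m + 2) (\<alpha> + \<beta> * t) - real m * flat (m + 1) (\<alpha> + \<beta> * t)) * \<beta>) (at t)" for t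
    by (rule DERIV_chain2[OF flat_has_derivative]) (auto intro!: derivative_eq_intros)
  from has_derivative_comp_coord[OF this]
  have d: "(?F m has_derivative (\<lambda>h. (?F (m + 2) x - real m * ?F (m + 1) x) * \<beta> * h $ i)) (at x)" for x .
  then have "partial_deriv j (?F m) = (\<lambda>x. (?F (m + 2) x + (- real m) * ?F (m + 1) x) * (\<beta> * axis j 1 $ i))" for j
    by (intro ext) (use partial_deriv_eqI[OF d] in simp)
  moreover have "smooth_expr (\<lambda>x. (?F (m + 2) x + (- real m) * ?F (m + 1) x) * (\<beta> * axis j 1 $ i))" for j
    by (intro smooth_expr.mult smooth_expr.add smooth_expr.const smooth_expr.flat)
  ultimately show ?case using differentiableI[OF d] by metis
next
  case (add f g)
  then have d: "(f has_derivative frechet_derivative f (at x)) (at x)"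
    "(g has_derivative frechet_derivative g (at x)) (at x)" for x
    using frechet_derivative_works by blast+
  have "partial_deriv i (\<lambda>x. f x + g x) = (\<lambda>x. partial_deriv i f x + partial_deriv i g x)" for i
    using partial_deriv_eqI[OF has_derivative_add[OF d]] by (simp add: fun_eq_iff partial_deriv_def)
  with add show ?case by (auto intro!: smooth_expr.add)
next
  case (mult f g)
  then have d: "(f has_derivative frechet_derivative f (at x)) (at x)"
    "(g has_derivative frechet_derivative g (at x)) (at x)" for x
    using frechet_derivative_works by blast+
  have "partial_deriv i (\<lambda>x. f x * g x) = (\<lambda>x. f x * partial_deriv i g x + partial_deriv i f x * g x)" for i
    using partial_deriv_eqI[OF has_derivative_mult[OF d]] by (simp add: fun_eq_iff partial_deriv_def)
  with mult show ?case by (auto intro!: smooth_expr.add smooth_expr.mult)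
qed

lemma smooth_expr_smooth:
  assumes "smooth_expr f" shows "smooth f"
proof -
  have "smooth_expr (foldr partial_deriv js f)" for js
    by (induction js) (use assms smooth_expr_differentiable in auto)
  then show ?thesis unfolding smooth_def using smooth_expr_differentiable by blast
qed

section \<open>Closure properties of smooth functions\<close>

lemma smooth_const: "smooth (\<lambda>_. c)"
  by (rule smooth_expr_smooth[OF smooth_expr.const])

lemma smooth_coord: "smooth (\<lambda>x. x $ i)"
  by (rule smooth_expr_smooth[OF smooth_expr.coord])

lemma smooth_flat: "smooth (\<lambda>x. flat m (\<alpha> + \<beta> * x $ i))"
  by (rule smooth_expr_smooth[OF smooth_expr.flat])

lemma smooth_add: "smooth f \<Longrightarrow> smooth g \<Longrightarrow> smooth (\<lambda>x. f x + g x)"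
  by (rule smooth_expr_smooth[OF smooth_expr.add[OF smooth_expr.base smooth_expr.base]])

lemma smooth_mult: "smooth f \<Longrightarrow> smooth g \<Longrightarrow> smooth (\<lambda>x. f x * g x)"
  by (rule smooth_expr_smooth[OF smooth_expr.mult[OF smooth_expr.base smooth_expr.base]])

lemma smooth_diff: "smooth f \<Longrightarrow> smooth g \<Longrightarrow> smooth (\<lambda>x. f x - g x)"
  using smooth_add[OF _ smooth_mult[OF smooth_const[of "-1"]]] by simp

lemma smooth_power: "smooth f \<Longrightarrow> smooth (\<lambda>x. f x ^ n)"
  by (induction n) (simp_all add: smooth_const smooth_mult)

lemma smooth_sum: "(\<And>k. k \<in> A \<Longrightarrow> smooth (f k)) \<Longrightarrow> smooth (\<lambda>x. \<Sum>k\<in>A. f k x)"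
  by (induction A rule: infinite_finite_induct) (simp_all add: smooth_const smooth_add)

lemma smooth_prod: "(\<And>k. k \<in> A \<Longrightarrow> smooth (f k)) \<Longrightarrow> smooth (\<lambda>x. \<Prod>k\<in>A. f k x)"
  by (induction A rule: infinite_finite_induct) (simp_all add: smooth_const smooth_mult)

lemma partial_deriv_mult:
  assumes "smooth f" "smooth g"
  shows "partial_deriv i (\<lambda>x. f x * g x) x = f x * partial_deriv i g x + partial_deriv i f x * g x"
  using partial_deriv_eqI[OF has_derivative_mult[OF assms[THEN smooth_differentiable, THEN frechet_derivative_works[THEN iffD1]]]]
  by (simp add: partial_deriv_def)

section \<open>Square-integrable functions\<close>

lemma L2_mult_integrable:
  assumes "f \<in> L2 M" "g \<in> L2 M"
  shows "integrable M (\<lambda>x. f x * g x)"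
proof (rule Bochner_Integration.integrable_bound)
  show "integrable M (\<lambda>x. (f x)\<^sup>2 + (g x)\<^sup>2)" using assms by (simp add: L2_def)
  show "(\<lambda>x. f x * g x) \<in> borel_measurable M" using assms by (auto simp: L2_def)
  have "\<bar>f x * g x\<bar> \<le> (f x)\<^sup>2 + (g x)\<^sup>2" for x
  proof -
    have "2 * (\<bar>f x\<bar> * \<bar>g x\<bar>) \<le> (f x)\<^sup>2 + (g x)\<^sup>2"
      using sum_squares_bound[of "\<bar>f x\<bar>" "\<bar>g x\<bar>"] by simp
    moreover have "0 \<le> \<bar>f x\<bar> * \<bar>g x\<bar>" by simp
    ultimately show ?thesis unfolding abs_mult by linarith
  qed
  then show "AE x in M. norm (f x * g x) \<le> norm ((f x)\<^sup>2 + (g x)\<^sup>2)"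
    by (simp add: order_trans[OF _ abs_ge_self])
qed

lemma L2_integrable_power2: "f \<in> L2 M \<Longrightarrow> integrable M (\<lambda>x. (f x)\<^sup>2)"
  by (simp add: L2_def)

lemma L2_add:
  assumes "f \<in> L2 M" "g \<in> L2 M"
  shows "(\<lambda>x. f x + g x) \<in> L2 M"
proof -
  have "(\<lambda>x. (f x + g x)\<^sup>2) = (\<lambda>x. (f x)\<^sup>2 + (g x)\<^sup>2 + 2 * (f x * g x))"
    by (simp add: fun_eq_iff power2_sum)
  moreover have "integrable M (\<lambda>x. (f x)\<^sup>2 + (g x)\<^sup>2 + 2 * (f x * g x))"
    using assms L2_mult_integrable[OF assms] by (intro Bochner_Integration.integrable_add) (auto simp: L2_def)
  ultimately show ?thesis using assms by (auto simp: L2_def)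
qed

lemma L2_mult_bounded:
  assumes f: "f \<in> L2 M" and h: "h \<in> borel_measurable M" and bd: "\<And>x. x \<in> space M \<Longrightarrow> \<bar>h x\<bar> \<le> C"
  shows "(\<lambda>x. h x * f x) \<in> L2 M"
proof -
  have "integrable M (\<lambda>x. (h x * f x)\<^sup>2)"
  proof (rule Bochner_Integration.integrable_bound)
    show "integrable M (\<lambda>x. C\<^sup>2 * (f x)\<^sup>2)" using f by (simp add: L2_def)
    show "(\<lambda>x. (h x * f x)\<^sup>2) \<in> borel_measurable M" using f h by (auto simp: L2_def)
    have "norm ((h x * f x)\<^sup>2) \<le> norm (C\<^sup>2 * (f x)\<^sup>2)" if "x \<in> space M" for x
      using power_mono[OF bd[OF that] abs_ge_zero, of 2]
      by (simp add: power_mult_distrib abs_mult mult_right_mono)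
    then show "AE x in M. norm ((h x * f x)\<^sup>2) \<le> norm (C\<^sup>2 * (f x)\<^sup>2)" by (auto intro: AE_I2)
  qed
  with f h show ?thesis by (auto simp: L2_def)
qed

lemma L2_diff:
  assumes "f \<in> L2 M" "g \<in> L2 M"
  shows "(\<lambda>x. f x - g x) \<in> L2 M"
  using L2_add[OF assms(1) L2_mult_bounded[OF assms(2), of "\<lambda>_. -1" 1]] by simp

text \<open>The integral of \<open>(f + t g)\<^sup>2\<close> is a nonnegative quadratic polynomial
  in \<open>t\<close>. Its value at the minimiser \<open>- B / C\<close> gives the claim; for
  \<open>C = 0\<close> it is affine and therefore constant.\<close>

lemma L2_Cauchy_Schwarz:
  assumes f: "f \<in> L2 M" and g: "g \<in> L2 M"
  shows "(\<integral>x. f x * g x \<partial>M)\<^sup>2 \<le> (\<integral>x. (f x)\<^sup>2 \<partial>M) * (\<integral>x. (g x)\<^sup>2 \<partial>M)"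
proof -
  define A where "A = (\<integral>x. (f x)\<^sup>2 \<partial>M)"
  define B where "B = (\<integral>x. f x * g x \<partial>M)"
  define C where "C = (\<integral>x. (g x)\<^sup>2 \<partial>M)"
  note int = L2_integrable_power2[OF f] L2_integrable_power2[OF g] L2_mult_integrable[OF f g]
  have q: "0 \<le> A + 2 * t * B + t\<^sup>2 * C" for t
  proof -
    have "0 \<le> (\<integral>x. (f x + t * g x)\<^sup>2 \<partial>M)" by simp
    also have "(\<lambda>x. (f x + t * g x)\<^sup>2) = (\<lambda>x. (f x)\<^sup>2 + 2 * t * (f x * g x) + t\<^sup>2 * (g x)\<^sup>2)"
      by (simp add: fun_eq_iff power2_sum power_mult_distrib algebra_simps)
    finally show ?thesis by (simp add: A_def B_def C_def int)
  qed
  have "C \<ge> 0" by (simp add: C_def)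
  show ?thesis
  proof (cases "C = 0")
    case True
    have "B = 0"
    proof (rule ccontr)
      assume "B \<noteq> 0"
      \<comment> \<open>This \<open>t\<close> makes \<open>A + 2 * t * B\<close> equal to
        -1.\<close>
      with q[of "- (A + 1) / (2 * B)"] True show False by (simp add: field_simps)
    qed
    with True show ?thesis by (simp add: B_def C_def)
  next
    case False
    with \<open>C \<ge> 0\<close> have "C > 0" by simp
    then have "0 \<le> A - B\<^sup>2 / C" using q[of "- B / C"] by (simp add: power2_eq_square field_simps)
    with \<open>C > 0\<close> show ?thesis by (simp add: field_simps A_def B_def C_def)
  qed
qed

lemma tendsto_L2_integral_mult:
  assumes f: "tendsto_L2 M f F" and g: "g \<in> L2 M"
  shows "(\<lambda>n. \<integral>x. f n x * g x \<partial>M) \<longlonglongrightarrow> (\<integral>x. F x * g x \<partial>M)"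
proof -
  have L: "f n \<in> L2 M" "F \<in> L2 M" for n using f by (auto simp: tendsto_L2_def)
  have lim: "(\<lambda>n. (\<integral>x. (f n x - F x)\<^sup>2 \<partial>M) * (\<integral>x. (g x)\<^sup>2 \<partial>M)) \<longlonglongrightarrow> 0 * (\<integral>x. (g x)\<^sup>2 \<partial>M)"
    using f by (intro tendsto_intros) (simp add: tendsto_L2_def)
  have "(\<lambda>n. (\<integral>x. (f n x - F x) * g x \<partial>M)\<^sup>2) \<longlonglongrightarrow> 0"
    by (rule tendsto_sandwich[OF _ _ tendsto_const])
       (use lim L2_Cauchy_Schwarz[OF L2_diff[OF L] g] in \<open>auto\<close>)
  then have "(\<lambda>n. \<integral>x. (f n x - F x) * g x \<partial>M) \<longlonglongrightarrow> 0"
    by simp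
  moreover have "(\<integral>x. (f n x - F x) * g x \<partial>M) = (\<integral>x. f n x * g x \<partial>M) - (\<integral>x. F x * g x \<partial>M)" for n
    using L2_mult_integrable[OF L(1) g] L2_mult_integrable[OF L(2) g] by (simp add: left_diff_distrib)
  ultimately show ?thesis by (simp add: LIM_zero_iff)
qed

lemma tendsto_L2_norm:
  assumes f: "tendsto_L2 M f F"
  shows "(\<lambda>n. \<integral>x. (f n x)\<^sup>2 \<partial>M) \<longlonglongrightarrow> (\<integral>x. (F x)\<^sup>2 \<partial>M)"
proof -
  have L: "f n \<in> L2 M" "F \<in> L2 M" for n using f by (auto simp: tendsto_L2_def)
  note int = L2_integrable_power2[OF L2_diff[OF L]] L2_mult_integrable[OF L] L2_integrable_power2[OF L(2)]
  \<comment> \<open>Expanding around \<open>F\<close> leaves one term that tends to 0 by hypothesis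
    and one that is linear in \<open>f n\<close>, which \<open>tendsto_L2_integral_mult\<close>
    covers.\<close>
  have "(\<integral>x. (f n x)\<^sup>2 \<partial>M) = (\<integral>x. (f n x - F x)\<^sup>2 + 2 * (f n x * F x) - (F x)\<^sup>2 \<partial>M)" for n
    by (rule Bochner_Integration.integral_cong) (simp_all add: power2_eq_square algebra_simps)
  then have "(\<integral>x. (f n x)\<^sup>2 \<partial>M) = (\<integral>x. (f n x - F x)\<^sup>2 \<partial>M) + 2 * (\<integral>x. f n x * F x \<partial>M) - (\<integral>x. (F x)\<^sup>2 \<partial>M)" for n
    by (simp add: int)
  moreover have "(\<lambda>n. (\<integral>x. (f n x - F x)\<^sup>2 \<partial>M) + 2 * (\<integral>x. f n x * F x \<partial>M) - (\<integral>x. (F x)\<^sup>2 \<partial>M))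
    \<longlonglongrightarrow> 0 + 2 * (\<integral>x. F x * F x \<partial>M) - (\<integral>x. (F x)\<^sup>2 \<partial>M)"
    using f by (intro tendsto_intros tendsto_L2_integral_mult L) (simp add: tendsto_L2_def)
  ultimately show ?thesis by (simp add: power2_eq_square)
qed

section \<open>Integration over the square\<close>

text \<open>Addition on the type \<open>2\<close> is modulo 2, so \<open>i + 1\<close> is the
  direction other than \<open>i\<close>, and \<open>i + 1 + 1\<close> is \<open>i\<close> again. The
  lemmas below can thus treat both directions at once.\<close>

lemma cases_2: "(j::2) = i \<or> j = i + 1"
  using exhaust_2[of i] exhaust_2[of j] by auto

lemma UNIV_2_eq_insert: "(UNIV::2 set) = {i, i + 1}" and add_1_neq_2: "(i::2) + 1 \<noteq> i"
  using cases_2[of _ i] by auto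

lemma forall_2_iff: "(\<forall>j::2. P j) \<longleftrightarrow> P i \<and> P (i + 1)"
  using UNIV_2_eq_insert[of i] by (metis UNIV_I insertE singletonD)

lemma side_point_nth: "side_point ((i, s), t) $ j = (if j = i then s else t)"
  by (simp add: side_point_def)

lemma side_point_in_square: "side_point ((i, s), t) \<in> square \<longleftrightarrow> s \<in> {-1..1} \<and> t \<in> {-1..1}"
  unfolding square_def mem_box_cart forall_2_iff[of _ i] by (auto simp: side_point_nth add_1_neq_2)

lemma side_point_swap: "side_point ((i, s), t) = side_point ((i + 1, t), s)"
  using cases_2[of _ i] add_1_neq_2[of i] by (auto simp: vec_eq_iff side_point_nth)

lemma side_point_alt: "side_point ((i, s), t) = s *\<^sub>R axis i 1 + t *\<^sub>R axis (i + 1) 1"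
  using cases_2[of _ i] add_1_neq_2[of i] by (auto simp: vec_eq_iff side_point_nth axis_def)

lemma continuous_on_side_point: "continuous_on S (\<lambda>(s, t). side_point ((i, s), t))"
  unfolding side_point_alt case_prod_unfold by (intro continuous_intros)

text \<open>The map identifies pairs with vectors up to the order of the coordinates; it preserves
  the volume of boxes, and that determines \<open>lborel\<close>. It carries integrals over
  \<open>real^2\<close> to a product, where Fubini's theorem applies.\<close>

lemma lborel_side_point: "distr lborel borel (\<lambda>(s, t). side_point ((i, s), t)) = lborel"
proof (rule lborel_eqI[symmetric])
  have m: "(\<lambda>(s, t). side_point ((i, s), t)) \<in> borel \<rightarrow>\<^sub>M borel"
    by (rule borel_measurable_continuous_onI[OF continuous_on_side_point])
  fix l u :: "real^2" assume lu: "\<And>b. b \<in> Basis \<Longrightarrow> l \<bullet> b \<le> u \<bullet> b"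
  have le: "l $ j \<le> u $ j" for j using lu[of "axis j 1"] by (simp add: inner_axis)
  have "(\<lambda>(s, t). side_point ((i, s), t)) -` box l u = box (l $ i, l $ (i+1)) (u $ i, u $ (i+1))"
    unfolding box_prod set_eq_iff mem_Times_iff vimage_eq mem_box_cart forall_2_iff[of _ i] split_paired_all
    by (simp add: side_point_nth add_1_neq_2)
  then have "emeasure (distr lborel borel (\<lambda>(s, t). side_point ((i, s), t))) (box l u)
     = emeasure (lborel \<Otimes>\<^sub>M lborel) (box (l $ i) (u $ i) \<times> box (l $ (i+1)) (u $ (i+1)))"
    using m by (subst emeasure_distr) (auto simp: box_prod lborel_prod)
  also have "\<dots> = ennreal (u $ i - l $ i) * ennreal (u $ (i+1) - l $ (i+1))"
    using le by (subst lborel.emeasure_pair_measure_Times) auto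
  also have "\<dots> = ennreal (\<Prod>b\<in>Basis. (u - l) \<bullet> b)"
  proof -
    have B: "Basis = (\<lambda>j. axis j (1::real)) ` (UNIV :: 2 set)" by (auto simp: Basis_vec_def)
    have "(\<Prod>b\<in>(Basis::(real^2) set). (u - l) \<bullet> b) = (\<Prod>j\<in>(UNIV::2 set). u $ j - l $ j)"
      unfolding B by (subst prod.reindex) (auto simp: inj_on_def axis_eq_axis inner_axis)
    also have "\<dots> = (u $ i - l $ i) * (u $ (i+1) - l $ (i+1))"
      unfolding UNIV_2_eq_insert[of i] using add_1_neq_2[of i] by auto
    finally show ?thesis using le by (simp add: ennreal_mult)
  qed
  finally show "emeasure (distr lborel borel (\<lambda>(s, t). side_point ((i, s), t))) (box l u) = (\<Prod>b\<in>Basis. (u - l) \<bullet> b)" .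
qed simp

lemma continuous_L2:
  fixes f :: "'a::euclidean_space \<Rightarrow> real"
  assumes "continuous_on (cbox a b) f"
  shows "f \<in> L2 (lebesgue_on (cbox a b))"
  unfolding L2_def using assms
  by (auto intro!: continuous_imp_integrable continuous_intros
        borel_measurable_integrable[OF continuous_imp_integrable])

lemma smooth_L2: "smooth f \<Longrightarrow> f \<in> L2 (lebesgue_on square)"
  unfolding square_def by (intro continuous_L2 smooth_continuous_on)

lemma continuous_on_compose_side_point:
  assumes "continuous_on UNIV f"
  shows "continuous_on S (\<lambda>(s, t). f (side_point ((i, s), t)))"
  using continuous_on_compose2[OF assms continuous_on_side_point] by (simp add: case_prod_unfold)

lemma continuous_on_side:
  assumes "continuous_on UNIV f"
  shows "continuous_on S (\<lambda>t. f (side_point ((i, s), t)))"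
    and "continuous_on S (\<lambda>s. f (side_point ((i, s), t)))"
  using assms by (auto simp: side_point_alt intro!: continuous_intros continuous_on_compose2[OF assms])

lemma integral_square:
  fixes f :: "real^2 \<Rightarrow> real"
  assumes f: "continuous_on UNIV f"
  shows "(\<integral>x. f x \<partial>lebesgue_on square) =
    integral {-1..1} (\<lambda>t. integral {-1..1} (\<lambda>s. f (side_point ((i, s), t))))"
proof -
  have sq: "square \<in> sets borel" by (simp add: square_def)
  have fm: "f \<in> borel_measurable borel" by (rule borel_measurable_continuous_onI[OF f])
  \<comment> \<open>Fubini makes the first component of the pair the outer variable. Parametrizing
    by the other direction leaves coordinate \<open>i\<close> as the inner variable, after
    \<open>side_point_swap\<close>.\<close>
  define i' where "i' = i + 1"
  define P where "P = (\<lambda>(s, t). side_point ((i', s), t))"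
  have Pm: "P \<in> lborel \<rightarrow>\<^sub>M borel"
    unfolding P_def by (simp add: borel_measurable_continuous_onI[OF continuous_on_side_point])
  have fP: "continuous_on S (\<lambda>x. f (P x))" for S
    using continuous_on_compose_side_point[OF f] by (simp add: P_def case_prod_unfold)
  have "(\<integral>x. f x \<partial>lebesgue_on square) = (\<integral>x. indicator square x *\<^sub>R f x \<partial>lebesgue)"
    by (rule integral_restrict_space) (use sq in auto)
  also have "\<dots> = (\<integral>x. indicator square x *\<^sub>R f x \<partial>lborel)"
    by (rule integral_completion) (use sq fm in measurable)
  also have "\<dots> = (\<integral>x. indicator square x *\<^sub>R f x \<partial>distr lborel borel P)"
    unfolding P_def lborel_side_point ..
  also have "\<dots> = (\<integral>x. indicator square (P x) *\<^sub>R f (P x) \<partial>lborel)"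
    by (rule integral_distr[OF Pm]) (use sq fm in measurable)
  also have "\<dots> = (LINT x : cbox (-1,-1) (1,1) | lborel. f (P x))"
  proof -
    have "indicator square (P x) = (indicator (cbox (-1,-1) (1,1)) x :: real)" for x
      by (cases x) (auto simp: P_def side_point_in_square indicator_def)
    then show ?thesis by (simp add: set_lebesgue_integral_def)
  qed
  also have "\<dots> = integral (cbox (-1,-1) (1,1)) (\<lambda>x. f (P x))"
    by (rule set_borel_integral_eq_integral(2)[OF borel_integrable_compact[OF compact_cbox fP, folded set_integrable_def]])
  also have "\<dots> = integral (cbox (-1) 1) (\<lambda>t. integral (cbox (-1) 1) (\<lambda>s. f (P (t, s))))"
    by (rule integral_prod_continuous[OF fP])
  finally show ?thesis
    by (simp add: P_def i'_def side_point_swap[of i])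
qed

lemma smooth_side_has_derivative:
  assumes "smooth f"
  shows "((\<lambda>s. f (side_point ((i, s), t))) has_real_derivative partial_deriv i f (side_point ((i, s), t))) (at s)"
  using smooth_partial_deriv_along[OF assms, of "t *\<^sub>R axis (i + 1) 1" i s]
  by (simp add: side_point_alt add.commute)

lemma integral_square_partial_deriv:
  assumes f: "smooth f"
  shows "(\<integral>x. partial_deriv i f x \<partial>lebesgue_on square) =
    integral {-1..1} (\<lambda>t. f (side_point ((i, 1), t)) - f (side_point ((i, -1), t)))"
proof -
  have "integral {-1..1} (\<lambda>s. partial_deriv i f (side_point ((i, s), t)))
      = f (side_point ((i, 1), t)) - f (side_point ((i, -1), t))" for t
    by (rule integral_unique[OF fundamental_theorem_of_calculus])
       (use smooth_side_has_derivative[OF f]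
        in \<open>auto simp: has_real_derivative_iff_has_vector_derivative[symmetric] intro: has_field_derivative_at_within\<close>)
  then show ?thesis
    using integral_square[OF smooth_continuous_on[OF smooth_partial_deriv[OF f]], of i i] by simp
qed

text \<open>The Jacobian determinant is a divergence. Since \<open>\<psi>\<close> is constant along the sides orthogonal to
  the direction \<open>i + 1\<close>, only the two sides orthogonal to \<open>i\<close> contribute.\<close>

lemma integral_square_jacobian:
  assumes \<phi>: "smooth \<phi>" and \<psi>: "smooth \<psi>"
    and zero: "\<And>s t. \<bar>t\<bar> = 1 \<Longrightarrow> partial_deriv i \<psi> (side_point ((i, s), t)) = 0"
  shows "(\<integral>x. partial_deriv i \<phi> x * partial_deriv (i + 1) \<psi> x
            - partial_deriv (i + 1) \<phi> x * partial_deriv i \<psi> x \<partial>lebesgue_on square) =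
    integral {-1..1} (\<lambda>t. \<phi> (side_point ((i, 1), t)) * partial_deriv (i + 1) \<psi> (side_point ((i, 1), t))
      - \<phi> (side_point ((i, -1), t)) * partial_deriv (i + 1) \<psi> (side_point ((i, -1), t)))"
proof -
  define F where "F = (\<lambda>x. \<phi> x * partial_deriv (i + 1) \<psi> x)"
  define G where "G = (\<lambda>x. \<phi> x * partial_deriv i \<psi> x)"
  have F: "smooth F" and G: "smooth G"
    unfolding F_def G_def by (intro smooth_mult smooth_partial_deriv \<phi> \<psi>)+
  \<comment> \<open>By \<open>smooth_partial_deriv_commute\<close> the two terms with mixed second
    derivatives of \<open>\<psi>\<close> cancel.\<close>
  have "partial_deriv i \<phi> x * partial_deriv (i + 1) \<psi> x - partial_deriv (i + 1) \<phi> x * partial_deriv i \<psi> x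
     = partial_deriv i F x - partial_deriv (i + 1) G x" for x
    unfolding F_def G_def
    by (simp add: partial_deriv_mult \<phi> \<psi> smooth_partial_deriv smooth_partial_deriv_commute[OF \<psi>, of i])
  moreover have "integrable (lebesgue_on square) (partial_deriv j H)" if "smooth H" for j H
    unfolding square_def
    by (intro continuous_imp_integrable smooth_continuous_on smooth_partial_deriv that)
  ultimately have "(\<integral>x. partial_deriv i \<phi> x * partial_deriv (i + 1) \<psi> x
            - partial_deriv (i + 1) \<phi> x * partial_deriv i \<psi> x \<partial>lebesgue_on square)
     = (\<integral>x. partial_deriv i F x \<partial>lebesgue_on square) - (\<integral>x. partial_deriv (i + 1) G x \<partial>lebesgue_on square)"
    using F G by simp
  \<comment> \<open>This boundary term lives on the sides orthogonal to direction
    \<open>i + 1\<close>, where the tangential derivative \<open>partial_deriv i \<psi>\<close> in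
    \<open>G\<close> is zero.\<close>
  moreover have "(\<integral>x. partial_deriv (i + 1) G x \<partial>lebesgue_on square) = 0"
    unfolding integral_square_partial_deriv[OF G]
    by (simp add: G_def zero side_point_swap[of i, symmetric])
  ultimately show ?thesis
    using integral_square_partial_deriv[OF F, of i] by (simp add: F_def)
qed

section \<open>Weighted Hardy estimates with boundary values\<close>

lemma integral_Cauchy_Schwarz:
  fixes f :: "real \<Rightarrow> real"
  assumes "continuous_on {a..b} f" "continuous_on {a..b} g"
  shows "(integral {a..b} (\<lambda>t. f t * g t))\<^sup>2 \<le> integral {a..b} (\<lambda>t. (f t)\<^sup>2) * integral {a..b} (\<lambda>t. (g t)\<^sup>2)"
proof -
  have "(\<integral>x. h x \<partial>lebesgue_on {a..b}) = integral {a..b} h" if "continuous_on {a..b} h" for h :: "real \<Rightarrow> real"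
    by (rule lebesgue_integral_eq_integral[OF continuous_imp_integrable_real[OF that]]) simp
  moreover have "f \<in> L2 (lebesgue_on {a..b})" "g \<in> L2 (lebesgue_on {a..b})"
    using continuous_L2[of a b f] continuous_L2[of a b g] assms by auto
  ultimately show ?thesis
    using L2_Cauchy_Schwarz[of f "lebesgue_on {a..b}" g] assms by (simp add: continuous_intros)
qed

text \<open>Cauchy-Schwarz for \<open>g'\<close> against the constant 1, that is, Hoelder continuity
  of exponent 1/2. Integrating over the larger interval makes the last factor independent of
  \<open>a\<close> and \<open>b\<close>.\<close>

lemma power2_diff_le_integral:
  fixes g :: "real \<Rightarrow> real"
  assumes g: "\<And>s. (g has_real_derivative g' s) (at s)" and g': "continuous_on UNIV g'"
    and ab: "a \<le> b" "{a..b} \<subseteq> {c..d}"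
  shows "(g b - g a)\<^sup>2 \<le> (b - a) * integral {c..d} (\<lambda>s. (g' s)\<^sup>2)"
proof -
  have "integral {a..b} g' = g b - g a"
    by (rule integral_unique[OF fundamental_theorem_of_calculus])
       (use g ab in \<open>auto simp: has_real_derivative_iff_has_vector_derivative[symmetric] intro: has_field_derivative_at_within\<close>)
  then have "(g b - g a)\<^sup>2 \<le> (b - a) * integral {a..b} (\<lambda>s. (g' s)\<^sup>2)"
    using integral_Cauchy_Schwarz[of a b "\<lambda>_. 1" g'] g' ab continuous_on_subset[OF g'] by auto
  also have "\<dots> \<le> (b - a) * integral {c..d} (\<lambda>s. (g' s)\<^sup>2)"
    using ab by (intro mult_left_mono integral_subset_le)
      (auto intro!: integrable_continuous_real continuous_intros continuous_on_subset[OF g'])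
  finally show ?thesis .
qed

text \<open>Each point is compared with the endpoint nearer to it, at distance
  \<open>1 - \<bar>s\<bar>\<close>; this is the origin of the weight in \<open>V\<close>. Endpoint
  values are kept because smooth approximations vanish on the sides only in the limit. They carry
  the crude bound \<open>K\<close>, whereas the derivative, which need not tend to 0, carries
  \<open>V\<close>, which becomes small for the cutoff.\<close>

lemma weighted_hardy:
  fixes g :: "real \<Rightarrow> real"
  assumes g: "\<And>s. (g has_real_derivative g' s) (at s)" and g': "continuous_on UNIV g'"
    and w: "continuous_on {-1..1} w" "\<And>s. s \<in> {-1..1} \<Longrightarrow> 0 \<le> w s" "\<And>s. s \<in> {-1..1} \<Longrightarrow> w s \<le> K"
    and V: "integral {-1..1} (\<lambda>s. w s * (1 - \<bar>s\<bar>)) \<le> V"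
  shows "integral {-1..1} (\<lambda>s. w s * (g s)\<^sup>2)
    \<le> 4 * K * ((g 1)\<^sup>2 + (g (-1))\<^sup>2) + 2 * V * integral {-1..1} (\<lambda>s. (g' s)\<^sup>2)"
proof -
  define B where "B = (g 1)\<^sup>2 + (g (-1))\<^sup>2"
  define D where "D = integral {-1..1} (\<lambda>s. (g' s)\<^sup>2)"
  have D: "0 \<le> D" unfolding D_def by (rule integral_nonneg)
    (auto intro!: integrable_continuous_real continuous_intros continuous_on_subset[OF g'])
  have gc: "continuous_on S g" for S
    using g by (meson DERIV_isCont continuous_at_imp_continuous_on)
  have pw: "(g s)\<^sup>2 \<le> 2 * B + 2 * (1 - \<bar>s\<bar>) * D" if s: "s \<in> {-1..1}" for s
  proof -
    \<comment> \<open>Equivalent to \<open>0 \<le> (x - 2 * y)\<^sup>2\<close>; it separates the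
      endpoint value from the increment.\<close>
    have two: "x\<^sup>2 \<le> 2 * y\<^sup>2 + 2 * (x - y)\<^sup>2" for x y :: real
      using sum_squares_ge_zero[of "x - 2 * y" 0] by (simp add: power2_eq_square algebra_simps)
    show ?thesis
    proof (cases "0 \<le> s")
      case True
      then have "(g 1 - g s)\<^sup>2 \<le> (1 - s) * D"
        unfolding D_def using s by (intro power2_diff_le_integral g g') auto
      moreover have "(g 1)\<^sup>2 \<le> B" by (simp add: B_def)
      ultimately show ?thesis using two[of "g s" "g 1"] True
        by (simp add: power2_commute[of "g s"] left_diff_distrib)
    next
      case False
      then have "(g s - g (-1))\<^sup>2 \<le> (s - (-1)) * D"
        unfolding D_def using s by (intro power2_diff_le_integral g g') auto
      moreover have "(g (-1))\<^sup>2 \<le> B" by (simp add: B_def)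
      ultimately show ?thesis using two[of "g s" "g (-1)"] False
        by (simp add: distrib_right)
    qed
  qed
  have "integral {-1..1} (\<lambda>s. w s * (g s)\<^sup>2) \<le> integral {-1..1} (\<lambda>s. K * (2 * B) + 2 * D * (w s * (1 - \<bar>s\<bar>)))"
  proof (rule integral_le)
    fix s :: real assume s: "s \<in> {-1..1}"
    have "w s * (g s)\<^sup>2 \<le> w s * (2 * B + 2 * (1 - \<bar>s\<bar>) * D)"
      by (rule mult_left_mono[OF pw[OF s] w(2)[OF s]])
    also have "\<dots> = w s * (2 * B) + 2 * D * (w s * (1 - \<bar>s\<bar>))" by (simp add: algebra_simps)
    also have "w s * (2 * B) \<le> K * (2 * B)" using w(3)[OF s] by (intro mult_right_mono) (auto simp: B_def)
    finally show "w s * (g s)\<^sup>2 \<le> K * (2 * B) + 2 * D * (w s * (1 - \<bar>s\<bar>))" by simp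
  qed (auto intro!: integrable_continuous_real continuous_intros w gc)
  \<comment> \<open>The first term is constant on an interval of length 2, whence the factor
    \<open>4 * K\<close>.\<close>
  also have "\<dots> = 2 * (K * (2 * B)) + 2 * D * integral {-1..1} (\<lambda>s. w s * (1 - \<bar>s\<bar>))"
    by (subst integral_add)
       (auto intro!: integrable_continuous_real continuous_intros w simp: mult.assoc)
  also have "\<dots> \<le> 4 * K * B + 2 * V * D" using mult_left_mono[OF V D] by (simp add: algebra_simps)
  finally show ?thesis by (simp add: B_def D_def)
qed

lemma weighted_hardy_square:
  assumes \<psi>: "smooth \<psi>"
    and w: "continuous_on UNIV w" "\<And>s. s \<in> {-1..1} \<Longrightarrow> 0 \<le> w s" "\<And>s. s \<in> {-1..1} \<Longrightarrow> w s \<le> K"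
    and V: "integral {-1..1} (\<lambda>s. w s * (1 - \<bar>s\<bar>)) \<le> V"
  shows "(\<integral>x. w (x $ i) * (\<psi> x)\<^sup>2 \<partial>lebesgue_on square)
    \<le> 4 * K * (integral {-1..1} (\<lambda>t. (\<psi> (side_point ((i, 1), t)))\<^sup>2)
           + integral {-1..1} (\<lambda>t. (\<psi> (side_point ((i, -1), t)))\<^sup>2))
      + 2 * V * (\<integral>x. (partial_deriv i \<psi> x)\<^sup>2 \<partial>lebesgue_on square)"
proof -
  note c = smooth_continuous_on[OF \<psi>] smooth_continuous_on[OF smooth_partial_deriv[OF \<psi>]]
  have cp: "continuous_on {-1..1} (\<lambda>t. integral {-1..1} (\<lambda>s. f (side_point ((i, s), t))))"
    if "continuous_on UNIV f" for f :: "real^2 \<Rightarrow> real"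
  proof -
    have "continuous_on ({-1..1} \<times> cbox (-1) 1) (\<lambda>(t, s). f (side_point ((i, s), t)))"
      using continuous_on_compose_side_point[OF that, of _ "i + 1"] by (simp add: side_point_swap[of i])
    from integral_continuous_on_param[OF this] show ?thesis by simp
  qed
  have wc: "continuous_on UNIV (\<lambda>x. w (x $ i) * (\<psi> x)\<^sup>2)"
    by (intro continuous_intros c continuous_on_compose2[OF w(1)]) auto
  have dc: "continuous_on UNIV (\<lambda>x. (partial_deriv i \<psi> x)\<^sup>2)"
    by (intro continuous_intros c)
  have sc: "continuous_on UNIV (\<lambda>x. (\<psi> x)\<^sup>2)"
    by (intro continuous_intros c)
  have "(\<integral>x. w (x $ i) * (\<psi> x)\<^sup>2 \<partial>lebesgue_on square)
     = integral {-1..1} (\<lambda>t. integral {-1..1} (\<lambda>s. w s * (\<psi> (side_point ((i, s), t)))\<^sup>2))"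
    unfolding integral_square[OF wc, of i] by (simp add: side_point_nth)
  also have "\<dots> \<le> integral {-1..1} (\<lambda>t.
      4 * K * ((\<psi> (side_point ((i, 1), t)))\<^sup>2 + (\<psi> (side_point ((i, -1), t)))\<^sup>2)
      + 2 * V * integral {-1..1} (\<lambda>s. (partial_deriv i \<psi> (side_point ((i, s), t)))\<^sup>2))"
  proof (rule integral_le)
    show "(\<lambda>t. integral {-1..1} (\<lambda>s. w s * (\<psi> (side_point ((i, s), t)))\<^sup>2)) integrable_on {-1..1}"
      using integrable_continuous_real[OF cp[OF wc]] by (simp add: side_point_nth)
    show "(\<lambda>t. 4 * K * ((\<psi> (side_point ((i, 1), t)))\<^sup>2 + (\<psi> (side_point ((i, -1), t)))\<^sup>2)
      + 2 * V * integral {-1..1} (\<lambda>s. (partial_deriv i \<psi> (side_point ((i, s), t)))\<^sup>2)) integrable_on {-1..1}"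
      by (intro integrable_continuous_real continuous_intros cp[OF dc] continuous_on_side c)
  next
    fix t :: real assume "t \<in> {-1..1}"
    show "integral {-1..1} (\<lambda>s. w s * (\<psi> (side_point ((i, s), t)))\<^sup>2)
     \<le> 4 * K * ((\<psi> (side_point ((i, 1), t)))\<^sup>2 + (\<psi> (side_point ((i, -1), t)))\<^sup>2)
      + 2 * V * integral {-1..1} (\<lambda>s. (partial_deriv i \<psi> (side_point ((i, s), t)))\<^sup>2)"
      by (rule weighted_hardy[OF smooth_side_has_derivative[OF \<psi>] continuous_on_side(2)[OF c(2)]])
         (use w V continuous_on_subset[OF w(1)] in auto)
  qed
  also have "\<dots> = 4 * K * (integral {-1..1} (\<lambda>t. (\<psi> (side_point ((i, 1), t)))\<^sup>2)
           + integral {-1..1} (\<lambda>t. (\<psi> (side_point ((i, -1), t)))\<^sup>2))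
      + 2 * V * integral {-1..1} (\<lambda>t. integral {-1..1} (\<lambda>s. (partial_deriv i \<psi> (side_point ((i, s), t)))\<^sup>2))"
    using integrable_continuous_real[OF cp[OF dc]] integrable_continuous_real[OF continuous_on_side(1)[OF sc]]
    by (subst integral_add integral_mult_right | intro integrable_add integrable_on_mult_right | simp)+
  finally show ?thesis unfolding integral_square[OF dc, of i] .
qed

section \<open>Vanishing traces\<close>

lemma measurable_side_point:
  "side_point \<in> count_space (UNIV \<times> {-1, 1}) \<Otimes>\<^sub>M restrict_space lborel {-1..1} \<rightarrow>\<^sub>M borel"
proof (rule measurable_pair_measure_countable1)
  fix p :: "2 \<times> real" assume "p \<in> UNIV \<times> {-1, 1}"
  obtain i s where [simp]: "p = (i, s)" by force
  have "continuous_on UNIV (\<lambda>t. side_point ((i, s), t))"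
    by (simp add: side_point_alt continuous_intros)
  then have "(\<lambda>t. side_point ((i, s), t)) \<in> lborel \<rightarrow>\<^sub>M borel"
    by (simp add: borel_measurable_continuous_onI)
  then show "(\<lambda>t. side_point (p, t)) \<in> restrict_space lborel {-1..1} \<rightarrow>\<^sub>M borel"
    by (simp add: measurable_restrict_space1)
qed (auto intro: countable_finite)

text \<open>\<open>square_boundary_measure\<close> adds up the arc lengths of the four sides, so one
  side is a single summand. The bound serves to pass smallness from the whole boundary to one
  side.\<close>

lemma nn_integral_side_le:
  assumes f: "f \<in> borel_measurable borel" and s: "s \<in> {-1, 1}"
  shows "(\<integral>\<^sup>+t. f (side_point ((i, s), t)) * indicator {-1..1} t \<partial>lborel) \<le> (\<integral>\<^sup>+x. f x \<partial>square_boundary_measure)"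
proof -
  let ?R = "restrict_space lborel {-1..1::real}"
  have "finite_measure ?R" by (rule finite_measureI) (simp add: emeasure_restrict_space space_restrict_space)
  then interpret R: finite_measure ?R .
  have fs: "(\<lambda>x. f (side_point x)) \<in> borel_measurable (count_space (UNIV \<times> {-1, 1}) \<Otimes>\<^sub>M ?R)"
    by (rule measurable_compose[OF measurable_side_point f])
  have "(\<integral>\<^sup>+t. f (side_point ((i, s), t)) * indicator {-1..1} t \<partial>lborel)
      = (\<integral>\<^sup>+t. f (side_point ((i, s), t)) \<partial>?R)"
    by (subst nn_integral_restrict_space) auto
  also have "\<dots> \<le> (\<Sum>p\<in>UNIV \<times> {-1, 1}. \<integral>\<^sup>+t. f (side_point (p, t)) \<partial>?R)"
    using s by (intro member_le_sum[of "(i, s)" _ "\<lambda>p. \<integral>\<^sup>+t. f (side_point (p, t)) \<partial>?R"]) auto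
  also have "\<dots> = (\<integral>\<^sup>+p. \<integral>\<^sup>+t. f (side_point (p, t)) \<partial>?R \<partial>count_space (UNIV \<times> {-1, 1}))"
    by (rule nn_integral_count_space_finite[symmetric]) auto
  also have "\<dots> = (\<integral>\<^sup>+x. f (side_point x) \<partial>(count_space (UNIV \<times> {-1, 1}) \<Otimes>\<^sub>M ?R))"
    by (rule R.nn_integral_fst[OF fs])
  also have "\<dots> = (\<integral>\<^sup>+x. f x \<partial>square_boundary_measure)"
    unfolding square_boundary_measure_def by (rule nn_integral_distr[symmetric, OF measurable_side_point]) (use f in simp)
  finally show ?thesis .
qed

text \<open>Away from the corners the normal on this side is \<open>s\<close> times the
  \<open>i\<close>-th unit vector, so the boundary condition forces \<open>t i\<close> to vanish
  there. The integral of \<open>(\<phi> n)\<^sup>2\<close> over the side is then part of the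
  integral of \<open>(\<phi> n - t i)\<^sup>2\<close> over the boundary.\<close>

lemma trace_vanishes_on_side:
  assumes smooth: "\<And>n. smooth (\<phi> n)"
    and tr: "tendsto_L2 square_boundary_measure \<phi> (t i)"
    and zero: "AE x in square_boundary_measure. (\<Sum>k\<in>UNIV. square_normal x $ k * t k x) = 0"
    and s: "s \<in> {-1, 1}"
  shows "(\<lambda>n. integral {-1..1} (\<lambda>r. (\<phi> n (side_point ((i, s), r)))\<^sup>2)) \<longlonglongrightarrow> 0"
proof (rule tendsto_sandwich[OF _ _ tendsto_const])
  let ?M = square_boundary_measure
  show "(\<lambda>n. \<integral>x. (\<phi> n x - t i x)\<^sup>2 \<partial>?M) \<longlonglongrightarrow> 0" using tr by (simp add: tendsto_L2_def)
  note c = smooth_continuous_on[OF smooth]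
  have ci: "continuous_on S (\<lambda>r. (\<phi> n (side_point ((i, s), r)))\<^sup>2)" for S n
    by (intro continuous_intros continuous_on_side c)
  show "\<forall>\<^sub>F n in sequentially. 0 \<le> integral {-1..1} (\<lambda>r. (\<phi> n (side_point ((i, s), r)))\<^sup>2)"
    by (intro always_eventually allI integral_nonneg integrable_continuous_real ci) auto
  \<comment> \<open>The line through the side, minus the corners: there both components of
    \<open>square_normal\<close> are nonzero, and the condition does not separate \<open>t i\<close>
    from \<open>t (i + 1)\<close>.\<close>
  define A where "A = {x::real^2. x $ i = s \<and> \<bar>x $ (i + 1)\<bar> \<noteq> 1}"
  have [measurable]: "A \<in> sets borel"
  proof -
    have "A = {x. x $ i = s} - ({x. x $ (i + 1) = 1} \<union> {x. x $ (i + 1) = -1})" by (auto simp: A_def)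
    moreover have "closed {x::real^2. x $ k = v}" for k v
      by (intro closed_Collect_eq continuous_intros)
    ultimately show ?thesis by (simp add: borel_closed sets.Diff sets.Un)
  qed
  have AE0: "AE x in ?M. x \<in> A \<longrightarrow> t i x = 0"
    using zero
  proof eventually_elim
    case (elim x)
    have "(\<Sum>k\<in>UNIV. square_normal x $ k * t k x)
      = square_normal x $ i * t i x + square_normal x $ (i + 1) * t (i + 1) x"
      unfolding UNIV_2_eq_insert[of i] using add_1_neq_2[of i] by auto
    moreover have "square_normal x $ i = s" "square_normal x $ (i + 1) = 0" if "x \<in> A"
      using that s by (auto simp: A_def square_normal_def)
    ultimately show ?case using elim s by auto
  qed
  have "integral {-1..1} (\<lambda>r. (\<phi> n (side_point ((i, s), r)))\<^sup>2) \<le> (\<integral>x. (\<phi> n x - t i x)\<^sup>2 \<partial>?M)" for n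
  proof -
    let ?f = "\<lambda>r. (\<phi> n (side_point ((i, s), r)))\<^sup>2"
    have [measurable]: "\<phi> n \<in> borel_measurable borel" using c by (rule borel_measurable_continuous_onI)
    have int: "set_integrable lborel {-1..1} ?f"
      unfolding set_integrable_def by (rule borel_integrable_compact[OF compact_Icc ci])
    have L: "\<phi> n \<in> L2 ?M" "t i \<in> L2 ?M" using tr by (auto simp: tendsto_L2_def)
    have "ennreal (integral {-1..1} ?f) = ennreal (\<integral>r. indicator {-1..1} r *\<^sub>R ?f r \<partial>lborel)"
      using set_borel_integral_eq_integral(2)[OF int] by (simp add: set_lebesgue_integral_def)
    also have "\<dots> = (\<integral>\<^sup>+r. ennreal (indicator {-1..1} r *\<^sub>R ?f r) \<partial>lborel)"
      by (rule nn_integral_eq_integral[symmetric]) (use int in \<open>auto simp: set_integrable_def\<close>)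
    also have "\<dots> = (\<integral>\<^sup>+r. ennreal ((\<phi> n (side_point ((i, s), r)))\<^sup>2) * indicator A (side_point ((i, s), r)) * indicator {-1..1} r \<partial>lborel)"
    proof (rule nn_integral_cong_AE)
      show "AE r in lborel. ennreal (indicator {-1..1} r *\<^sub>R ?f r)
        = ennreal ((\<phi> n (side_point ((i, s), r)))\<^sup>2) * indicator A (side_point ((i, s), r)) * indicator {-1..1} r"
        using AE_lborel_singleton[of 1] AE_lborel_singleton[of "-1"]
        by eventually_elim (auto simp: A_def side_point_nth add_1_neq_2 indicator_def)
    qed
    also have "\<dots> \<le> (\<integral>\<^sup>+x. ennreal ((\<phi> n x)\<^sup>2) * indicator A x \<partial>?M)"
      by (rule nn_integral_side_le[OF _ s]) measurable
    also have "\<dots> \<le> (\<integral>\<^sup>+x. ennreal ((\<phi> n x - t i x)\<^sup>2) \<partial>?M)"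
      by (rule nn_integral_mono_AE) (use AE0 in \<open>eventually_elim, auto simp: indicator_def\<close>)
    also have "\<dots> = ennreal (\<integral>x. (\<phi> n x - t i x)\<^sup>2 \<partial>?M)"
      by (rule nn_integral_eq_integral) (use L2_integrable_power2[OF L2_diff[OF L]] in auto)
    finally show ?thesis by simp
  qed
  then show "\<forall>\<^sub>F n in sequentially. integral {-1..1} (\<lambda>r. (\<phi> n (side_point ((i, s), r)))\<^sup>2)
     \<le> (\<integral>x. (\<phi> n x - t i x)\<^sup>2 \<partial>?M)" by simp
qed

section \<open>A logarithmic cutoff\<close>

text \<open>The harmonic weights spread the derivative of the cutoff logarithmically, so that
  \<open>\<integral> (cutoff_deriv N t)\<^sup>2 * (1 - \<bar>t\<bar>)\<close> tends to \<open>0\<close>; this is what makes the localization error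
  vanish in the limit.\<close>

definition cutoff :: "nat \<Rightarrow> real \<Rightarrow> real" where
  "cutoff N t = 1 + (- 1 / harm N) * (\<Sum>k<N. (1 / real (Suc k)) * t ^ (2 * k + 2))"

definition cutoff_deriv :: "nat \<Rightarrow> real \<Rightarrow> real" where
  "cutoff_deriv N t = (- 1 / harm N) * (\<Sum>k<N. 2 * t ^ (2 * k + 1))"

lemma harm_sum: "harm N = (\<Sum>k<N. 1 / real (Suc k))"
  by (simp add: harm_def sum.atLeast1_atMost_eq inverse_eq_divide)

lemma harm_real_pos: "0 < N \<Longrightarrow> 0 < (harm N :: real)"
  by (simp add: harm_pos)

lemma cutoff_has_derivative: "(cutoff N has_real_derivative cutoff_deriv N t) (at t)"
proof -
  have "((\<lambda>t. (1 / real (Suc k)) * t ^ (2 * k + 2)) has_real_derivative 2 * t ^ (2 * k + 1)) (at t)" for k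
    by (rule DERIV_cong[OF DERIV_cmult[OF DERIV_pow]]) (simp add: field_simps)
  then have "((\<lambda>t. 1 + (- 1 / harm N) * (\<Sum>k<N. (1 / real (Suc k)) * t ^ (2 * k + 2)))
    has_real_derivative 0 + (- 1 / harm N) * (\<Sum>k<N. 2 * t ^ (2 * k + 1))) (at t)"
    by (intro DERIV_add DERIV_const DERIV_cmult DERIV_sum)
  then show ?thesis
    unfolding cutoff_def[abs_def] cutoff_deriv_def by simp
qed

lemma smooth_cutoff: "smooth (\<lambda>x. cutoff N (x $ i))"
  unfolding cutoff_def by (intro smooth_add smooth_mult smooth_const smooth_sum smooth_power smooth_coord)

lemma cutoff_continuous_on: "continuous_on S (cutoff N)" "continuous_on S (cutoff_deriv N)"
  unfolding cutoff_def cutoff_deriv_def by (intro continuous_intros)+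

lemma cutoff_boundary: "0 < N \<Longrightarrow> \<bar>t\<bar> = 1 \<Longrightarrow> cutoff N t = 0"
proof -
  assume N: "0 < N" and t: "\<bar>t\<bar> = 1"
  have "t ^ (2 * k + 2) = 1" for k
    using t power_even_abs[of "2 * k + 2" t] by simp
  then have "cutoff N t = 1 + (- 1 / harm N) * harm N" by (simp add: cutoff_def harm_sum)
  with less_imp_neq[OF harm_real_pos[OF N]] show ?thesis by simp
qed

lemma cutoff_bounds:
  assumes "0 < N" "\<bar>t\<bar> \<le> 1" shows "\<bar>cutoff N t\<bar> \<le> 1"
proof -
  let ?S = "\<Sum>k<N. (1 / real (Suc k)) * t ^ (2 * k + 2)"
  have "0 \<le> ?S" by (intro sum_nonneg mult_nonneg_nonneg zero_le_even_power) auto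
  moreover have "t ^ (2 * k + 2) \<le> 1" for k
    using power_le_one[of "\<bar>t\<bar>" "2 * k + 2"] assms power_even_abs[of "2 * k + 2" t] by simp
  then have "?S \<le> harm N" unfolding harm_sum
    by (intro sum_mono) (simp add: divide_right_mono)
  ultimately show ?thesis using harm_real_pos[OF assms(1)] by (auto simp: cutoff_def abs_le_iff field_simps)
qed

lemma harm_inverse_tendsto: "(\<lambda>N. c / harm N :: real) \<longlonglongrightarrow> 0"
  by (rule tendsto_divide_0[OF tendsto_const filterlim_at_top_imp_at_infinity[OF harm_at_top]])

text \<open>For fixed \<open>t\<close> the sums stay below a convergent geometric series, while the
  normalising factor \<open>harm N\<close> tends to infinity.\<close>

lemma cutoff_tendsto:
  assumes "\<bar>t\<bar> < 1" shows "(\<lambda>N. cutoff N t) \<longlonglongrightarrow> 1"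
proof -
  have t2: "t\<^sup>2 < 1" using assms by (simp add: abs_square_less_1)
  have b: "\<bar>\<Sum>k<N. (1 / real (Suc k)) * t ^ (2 * k + 2)\<bar> \<le> 1 / (1 - t\<^sup>2)" for N
  proof -
    have "\<bar>\<Sum>k<N. (1 / real (Suc k)) * t ^ (2 * k + 2)\<bar> = (\<Sum>k<N. (1 / real (Suc k)) * t ^ (2 * k + 2))"
      by (intro abs_of_nonneg sum_nonneg mult_nonneg_nonneg zero_le_even_power) auto
    also have "\<dots> \<le> (\<Sum>k<N. (t\<^sup>2) ^ k)"
    proof (rule sum_mono)
      fix k
      have "(1 / real (Suc k)) * t ^ (2 * k + 2) \<le> 1 * t ^ (2 * k + 2)"
        by (intro mult_right_mono zero_le_even_power) auto
      also have "\<dots> = (t\<^sup>2) ^ k * t\<^sup>2" by (simp add: power_mult power_add power2_eq_square)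
      also have "\<dots> \<le> (t\<^sup>2) ^ k * 1" using t2 by (intro mult_left_mono) auto
      finally show "(1 / real (Suc k)) * t ^ (2 * k + 2) \<le> (t\<^sup>2) ^ k" by simp
    qed
    also have "\<dots> \<le> (\<Sum>k. (t\<^sup>2) ^ k)" using t2 by (intro sum_le_suminf) (auto simp: summable_geometric)
    also have "\<dots> = 1 / (1 - t\<^sup>2)" using t2 by (simp add: suminf_geometric)
    finally show ?thesis .
  qed
  have "(\<lambda>N. (- 1 / harm N) * (\<Sum>k<N. (1 / real (Suc k)) * t ^ (2 * k + 2))) \<longlonglongrightarrow> 0"
  proof (rule Lim_null_comparison[OF always_eventually harm_inverse_tendsto[of "1 / (1 - t\<^sup>2)"]], rule allI)
    fix N
    show "norm ((- 1 / harm N) * (\<Sum>k<N. (1 / real (Suc k)) * t ^ (2 * k + 2))) \<le> 1 / (1 - t\<^sup>2) / harm N"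
      using mult_left_mono[OF b, of "1 / harm N" N] by (simp add: abs_mult harm_nonneg mult.commute[of "harm N"])
  qed
  from tendsto_add[OF tendsto_const[of 1] this] show ?thesis by (simp add: cutoff_def)
qed

lemma cutoff_deriv_abs: "\<bar>cutoff_deriv N t\<bar> = (1 / harm N) * (\<Sum>k<N. 2 * \<bar>t\<bar> ^ (2 * k + 1))"
proof -
  have "\<bar>\<Sum>k<N. 2 * t ^ (2 * k + 1)\<bar> = (\<Sum>k<N. 2 * \<bar>t\<bar> ^ (2 * k + 1))"
  proof (cases "0 \<le> t")
    case False
    then have "2 * t ^ (2 * k + 1) = - (2 * \<bar>t\<bar> ^ (2 * k + 1))" for k by simp
    then have "(\<Sum>k<N. 2 * t ^ (2 * k + 1)) = - (\<Sum>k<N. 2 * \<bar>t\<bar> ^ (2 * k + 1))"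
      by (simp only: sum_negf)
    moreover have "0 \<le> (\<Sum>k<N. 2 * \<bar>t\<bar> ^ (2 * k + 1))" by (intro sum_nonneg) auto
    ultimately show ?thesis by simp
  qed (auto intro!: abs_of_nonneg sum_nonneg)
  then show ?thesis by (simp add: cutoff_deriv_def abs_mult harm_nonneg)
qed

text \<open>The mark of a logarithmic profile: at distance \<open>1 - \<bar>t\<bar>\<close> from the
  boundary the slope is at most a multiple of the inverse distance. The weighted sum is dominated by
  a telescoping one.\<close>

lemma cutoff_deriv_weight:
  assumes "\<bar>t\<bar> \<le> 1" shows "\<bar>cutoff_deriv N t\<bar> * (1 - \<bar>t\<bar>) \<le> 2 / harm N"
proof -
  have "(\<Sum>k<N. 2 * r ^ (2 * k + 1)) * (1 - r) \<le> 2 * (1 - r ^ (2 * N))" if r: "0 \<le> r" "r \<le> 1" for r :: real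
  proof (induction N)
    case (Suc N)
    have "2 * r ^ (2 * N + 1) * (1 - r) = 2 * (1 - r) * r ^ (2 * N) * r" by simp
    \<comment> \<open>Enlarging the factor \<open>r\<close> to \<open>1 + r\<close> completes
      \<open>1 - r\<close> to \<open>1 - r\<^sup>2\<close>, which telescopes.\<close>
    also have "\<dots> \<le> 2 * (1 - r) * r ^ (2 * N) * (1 + r)" using r by (intro mult_left_mono) auto
    also have "\<dots> = 2 * (r ^ (2 * N) - r ^ (2 * Suc N))" by (simp add: algebra_simps)
    finally have "2 * r ^ (2 * N + 1) * (1 - r) \<le> 2 * (r ^ (2 * N) - r ^ (2 * Suc N))" .
    with Suc show ?case unfolding sum.lessThan_Suc distrib_right right_diff_distrib by linarith
  qed simp
  from order_trans[OF this[of "\<bar>t\<bar>", OF abs_ge_zero assms], of 2]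
  have "(\<Sum>k<N. 2 * \<bar>t\<bar> ^ (2 * k + 1)) * (1 - \<bar>t\<bar>) \<le> 2" by simp
  from mult_left_mono[OF this, of "1 / harm N"] show ?thesis
    by (simp add: cutoff_deriv_abs harm_nonneg mult.assoc)
qed

text \<open>\<open>K\<close> may depend on \<open>N\<close>: it will multiply boundary integrals
  that tend to 0 while \<open>N\<close> is fixed.\<close>

lemma cutoff_deriv_bounded: "\<exists>K. \<forall>t\<in>{-1..1}. (cutoff_deriv N t)\<^sup>2 \<le> K"
proof -
  have "bounded ((\<lambda>t. (cutoff_deriv N t)\<^sup>2) ` {-1..1})"
    by (intro compact_imp_bounded compact_continuous_image continuous_intros cutoff_continuous_on) simp
  then show ?thesis by (auto simp: bounded_iff)
qed

text \<open>One factor of the derivative is absorbed by the weight through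
  \<open>cutoff_deriv_weight\<close>, at the cost of \<open>2 / harm N\<close>. The bound used for
  the other has integral at most 4.\<close>

lemma cutoff_deriv_integral:
  "integral {-1..1} (\<lambda>t. (cutoff_deriv N t)\<^sup>2 * (1 - \<bar>t\<bar>)) \<le> 8 / harm N"
proof (cases "N = 0")
  case True
  then show ?thesis by (simp add: cutoff_deriv_def harm_nonneg)
next
  case False
  define H where "H = (harm N :: real)"
  have H: "0 < H" using harm_real_pos False by (simp add: H_def)
  have "integral {-1..1} (\<lambda>t. (cutoff_deriv N t)\<^sup>2 * (1 - \<bar>t\<bar>))
    \<le> integral {-1..1} (\<lambda>t. \<Sum>k<N. 4 / H\<^sup>2 * t ^ (2 * k))"
  proof (rule integral_le)
    fix t :: real assume t: "t \<in> {-1..1}"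
    have "(cutoff_deriv N t)\<^sup>2 * (1 - \<bar>t\<bar>) = \<bar>cutoff_deriv N t\<bar> * (\<bar>cutoff_deriv N t\<bar> * (1 - \<bar>t\<bar>))"
      by (simp add: power2_eq_square)
    also have "\<dots> \<le> \<bar>cutoff_deriv N t\<bar> * (2 / H)"
      using cutoff_deriv_weight[of t N] t by (intro mult_left_mono) (auto simp: H_def)
    also have "\<dots> = (2 / H\<^sup>2) * (\<Sum>k<N. 2 * \<bar>t\<bar> ^ (2 * k + 1))"
      by (simp add: cutoff_deriv_abs H_def power2_eq_square)
    \<comment> \<open>Lowering the odd exponents to even ones removes the absolute value. The
      integrals become \<open>2 / (2 * k + 1)\<close>, and bounding these by
      \<open>2 / (k + 1)\<close> brings back \<open>harm N\<close>.\<close>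
    also have "\<dots> \<le> (2 / H\<^sup>2) * (\<Sum>k<N. 2 * t ^ (2 * k))"
    proof (intro mult_left_mono sum_mono)
      fix k
      have "\<bar>t\<bar> ^ (2 * k + 1) \<le> \<bar>t\<bar> ^ (2 * k)" using t by (intro power_decreasing) auto
      then show "\<bar>t\<bar> ^ (2 * k + 1) \<le> t ^ (2 * k)" using power_even_abs[of "2 * k" t] by simp
    qed auto
    finally show "(cutoff_deriv N t)\<^sup>2 * (1 - \<bar>t\<bar>) \<le> (\<Sum>k<N. 4 / H\<^sup>2 * t ^ (2 * k))"
      by (simp add: sum_distrib_left mult.assoc)
  qed (use H in \<open>auto intro!: integrable_continuous_real continuous_intros cutoff_continuous_on\<close>)
  also have "\<dots> = (\<Sum>k<N. 4 / H\<^sup>2 * (2 / (2 * real k + 1)))"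
  proof -
    have "((\<lambda>t. t ^ (2 * k)) has_integral (2 / (2 * real k + 1))) {-1..1::real}" for k
    proof -
      have "((\<lambda>t. t ^ (2 * k)) has_integral (1 ^ (2 * k + 1) / (2 * real k + 1) - (-1) ^ (2 * k + 1) / (2 * real k + 1))) {-1..1::real}"
      proof (rule fundamental_theorem_of_calculus)
        fix t :: real
        have "((\<lambda>t. t ^ (2 * k + 1) / (2 * real k + 1)) has_real_derivative t ^ (2 * k)) (at t within {-1..1})"
          by (rule DERIV_cong[OF DERIV_cdivide[OF DERIV_pow]]) (simp add: field_simps)
        then show "((\<lambda>t. t ^ (2 * k + 1) / (2 * real k + 1)) has_vector_derivative t ^ (2 * k)) (at t within {-1..1})"
          by (simp add: has_real_derivative_iff_has_vector_derivative)
      qed simp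
      then show ?thesis by simp
    qed
    then have "((\<lambda>t. \<Sum>k<N. 4 / H\<^sup>2 * t ^ (2 * k)) has_integral (\<Sum>k<N. 4 / H\<^sup>2 * (2 / (2 * real k + 1)))) {-1..1::real}"
      by (intro has_integral_sum has_integral_mult_right) auto
    then show ?thesis by (rule integral_unique)
  qed
  also have "\<dots> \<le> (\<Sum>k<N. 4 / H\<^sup>2 * (2 * (1 / real (Suc k))))"
    using H by (intro sum_mono mult_left_mono) (auto simp: field_simps)
  also have "\<dots> = 8 / H\<^sup>2 * H" by (simp only: H_def harm_sum sum_distrib_left) (simp add: mult.assoc)
  also have "\<dots> = 8 / H" using H by (simp add: power2_eq_square)
  finally show ?thesis by (simp add: H_def)
qed

section \<open>The integral of the Jacobian determinant\<close>

lemma space_lebesgue_square: "space (lebesgue_on square) = square"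
  by (simp add: space_restrict_space)

lemma AE_interior_square: "AE x in lebesgue_on square. x \<in> box (-1) 1"
proof -
  have "negligible (square - box (-1) 1)"
    unfolding square_def by (rule negligible_frontier_interval)
  then have "AE x in lebesgue. x \<notin> square - box (-1) 1"
    using AE_not_in negligible_iff_null_sets by blast
  then show ?thesis
    by (subst AE_restrict_space_iff) (auto simp: square_def elim!: eventually_mono)
qed

lemma L2_mult_continuous:
  assumes f: "f \<in> L2 (lebesgue_on square)" and h: "continuous_on UNIV h"
  shows "(\<lambda>x. h x * f x) \<in> L2 (lebesgue_on square)"
proof -
  have "bounded (h ` square)"
    unfolding square_def
    by (intro compact_imp_bounded compact_continuous_image continuous_on_subset[OF h]) auto
  then obtain C where "\<And>x. x \<in> square \<Longrightarrow> \<bar>h x\<bar> \<le> C" by (auto simp: bounded_iff)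
  moreover have "h \<in> borel_measurable (lebesgue_on square)"
    by (intro measurable_restrict_space1 measurable_completion)
       (simp add: borel_measurable_continuous_onI[OF h])
  ultimately show ?thesis
    by (intro L2_mult_bounded[OF f]) (auto simp: space_lebesgue_square)
qed

lemma continuous_on_cutoff_coord:
  "continuous_on S (\<lambda>x. cutoff N (x $ i))" "continuous_on S (\<lambda>x. cutoff_deriv N (x $ i))"
  by (rule continuous_on_compose2[OF cutoff_continuous_on(1)[of UNIV] _ subset_UNIV]
      continuous_on_compose2[OF cutoff_continuous_on(2)[of UNIV] _ subset_UNIV]; intro continuous_intros)+

text \<open>The limit in \<open>\<phi> n\<close> has to be taken with \<open>\<psi>\<close> fixed: convergence of traces gives no
  control of the tangential derivatives of \<open>\<psi>\<close> on the boundary.\<close>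

lemma integral_jacobian_cutoff:
  assumes \<phi>: "\<And>n. smooth (\<phi> n)" and \<psi>: "smooth \<psi>" and N: "0 < N"
    and a: "tendsto_L2 (lebesgue_on square) (\<lambda>n. partial_deriv i (\<phi> n)) a"
    and b: "tendsto_L2 (lebesgue_on square) (\<lambda>n. partial_deriv (i + 1) (\<phi> n)) b"
    and \<phi>0: "\<And>s. s \<in> {-1, 1} \<Longrightarrow>
      (\<lambda>n. integral {-1..1} (\<lambda>r. (\<phi> n (side_point ((i, s), r)))\<^sup>2)) \<longlonglongrightarrow> 0"
  shows "(\<integral>x. cutoff N (x $ (i + 1)) * (a x * partial_deriv (i + 1) \<psi> x - b x * partial_deriv i \<psi> x) \<partial>lebesgue_on square)
    = - (\<integral>x. a x * (cutoff_deriv N (x $ (i + 1)) * \<psi> x) \<partial>lebesgue_on square)"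
proof -
  let ?M = "lebesgue_on square"
  define j where "j = i + 1"
  have ij: "i \<noteq> j" using add_1_neq_2[of i] by (simp add: j_def)
  define \<xi> where "\<xi> = (\<lambda>x::real^2. cutoff N (x $ j))"
  define \<xi>' where "\<xi>' = (\<lambda>x::real^2. cutoff_deriv N (x $ j))"
  \<comment> \<open>The cutoff depends on \<open>x $ j\<close> alone and is 0 at 1 and -1, so
    \<open>\<Psi>\<close> vanishes on the sides orthogonal to \<open>j\<close>, and so does its
    tangential derivative, as \<open>integral_square_jacobian\<close> requires. The product rule in
    direction \<open>j\<close> produces the right-hand side of the claim.\<close>
  define \<Psi> where "\<Psi> = (\<lambda>x. \<xi> x * \<psi> x)"
  have \<xi>: "smooth \<xi>" unfolding \<xi>_def by (rule smooth_cutoff)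
  have \<Psi>: "smooth \<Psi>" unfolding \<Psi>_def by (intro smooth_mult \<xi> \<psi>)
  have pd\<xi>: "partial_deriv k \<xi> x = \<xi>' x * axis k 1 $ j" for k x
    unfolding \<xi>_def \<xi>'_def by (rule partial_deriv_eqI[OF has_derivative_comp_coord[OF cutoff_has_derivative]])
  have \<Psi>i: "partial_deriv i \<Psi> x = \<xi> x * partial_deriv i \<psi> x" for x
    unfolding \<Psi>_def by (simp add: partial_deriv_mult[OF \<xi> \<psi>] pd\<xi> axis_def ij ij[symmetric])
  have \<Psi>j: "partial_deriv j \<Psi> x = \<xi> x * partial_deriv j \<psi> x + \<xi>' x * \<psi> x" for x
    unfolding \<Psi>_def by (simp add: partial_deriv_mult[OF \<xi> \<psi>] pd\<xi> axis_def)
  have L: "a \<in> L2 ?M" "b \<in> L2 ?M" "\<And>n. partial_deriv k (\<phi> n) \<in> L2 ?M" "partial_deriv k \<Psi> \<in> L2 ?M"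
      "partial_deriv k \<psi> \<in> L2 ?M" for k
    using a b by (auto simp: tendsto_L2_def intro!: smooth_L2 smooth_partial_deriv \<phi> \<Psi> \<psi>)
  define \<beta> where "\<beta> s n = integral {-1..1} (\<lambda>t. \<phi> n (side_point ((i, s), t)) * partial_deriv j \<Psi> (side_point ((i, s), t)))" for s n
  note c = smooth_continuous_on[OF \<phi>] smooth_continuous_on[OF smooth_partial_deriv[OF \<Psi>]]
  \<comment> \<open>\<open>\<Psi>\<close> does not depend on \<open>n\<close>, so Cauchy-Schwarz
    leaves a fixed factor times one that tends to 0 by \<open>\<phi>0\<close>.\<close>
  have \<beta>0: "\<beta> s \<longlonglongrightarrow> 0" if s: "s \<in> {-1, 1}" for s
  proof -
    have "(\<lambda>n. (\<beta> s n)\<^sup>2) \<longlonglongrightarrow> 0"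
    proof (rule tendsto_sandwich[OF _ _ tendsto_const])
      show "\<forall>\<^sub>F n in sequentially. (\<beta> s n)\<^sup>2 \<le> integral {-1..1} (\<lambda>r. (\<phi> n (side_point ((i, s), r)))\<^sup>2)
        * integral {-1..1} (\<lambda>r. (partial_deriv j \<Psi> (side_point ((i, s), r)))\<^sup>2)"
        unfolding \<beta>_def
        by (intro always_eventually allI integral_Cauchy_Schwarz continuous_on_side c)
      show "(\<lambda>n. integral {-1..1} (\<lambda>r. (\<phi> n (side_point ((i, s), r)))\<^sup>2)
        * integral {-1..1} (\<lambda>r. (partial_deriv j \<Psi> (side_point ((i, s), r)))\<^sup>2)) \<longlonglongrightarrow> 0"
        using tendsto_mult_right[OF \<phi>0[OF s]] by auto
    qed simp
    then show ?thesis by simp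
  qed
  have \<beta>_eq: "(\<integral>x. partial_deriv i (\<phi> n) x * partial_deriv j \<Psi> x \<partial>?M) - (\<integral>x. partial_deriv j (\<phi> n) x * partial_deriv i \<Psi> x \<partial>?M)
      = \<beta> 1 n - \<beta> (-1) n" for n
  proof -
    have "partial_deriv i \<Psi> (side_point ((i, s), t)) = 0" if "\<bar>t\<bar> = 1" for s t
      using cutoff_boundary[OF N that] ij by (simp add: \<Psi>i \<xi>_def side_point_nth)
    from integral_square_jacobian[OF \<phi> \<Psi> this, of n]
    have "(\<integral>x. partial_deriv i (\<phi> n) x * partial_deriv j \<Psi> x - partial_deriv j (\<phi> n) x * partial_deriv i \<Psi> x \<partial>?M)
      = integral {-1..1} (\<lambda>t. \<phi> n (side_point ((i, 1), t)) * partial_deriv j \<Psi> (side_point ((i, 1), t))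
        - \<phi> n (side_point ((i, -1), t)) * partial_deriv j \<Psi> (side_point ((i, -1), t)))"
      by (simp add: j_def)
    also have "\<dots> = \<beta> 1 n - \<beta> (-1) n" unfolding \<beta>_def
      by (rule integral_diff) (intro integrable_continuous_real continuous_intros continuous_on_side c)+
    finally show ?thesis
      by (simp add: Bochner_Integration.integral_diff L2_mult_integrable L)
  qed
  have \<beta>_lim: "(\<lambda>n. \<beta> 1 n - \<beta> (-1) n) \<longlonglongrightarrow> 0 - 0" by (intro tendsto_diff \<beta>0) auto
  have "(\<lambda>n. (\<integral>x. partial_deriv i (\<phi> n) x * partial_deriv j \<Psi> x \<partial>?M)
      - (\<integral>x. partial_deriv j (\<phi> n) x * partial_deriv i \<Psi> x \<partial>?M))
    \<longlonglongrightarrow> (\<integral>x. a x * partial_deriv j \<Psi> x \<partial>?M) - (\<integral>x. b x * partial_deriv i \<Psi> x \<partial>?M)"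
    using a b unfolding j_def[symmetric] by (intro tendsto_diff tendsto_L2_integral_mult L)
  from LIMSEQ_unique[OF this[unfolded \<beta>_eq] \<beta>_lim] have eq: "(\<integral>x. a x * partial_deriv j \<Psi> x \<partial>?M) - (\<integral>x. b x * partial_deriv i \<Psi> x \<partial>?M) = 0"
    by simp
  have \<xi>c: "continuous_on UNIV \<xi>" "continuous_on UNIV \<xi>'"
    unfolding \<xi>_def \<xi>'_def
    by (rule continuous_on_cutoff_coord)+
  note L' = L2_mult_continuous[OF L(5) \<xi>c(1)] L2_mult_continuous[OF smooth_L2[OF \<psi>] \<xi>c(2)]
  have "(\<integral>x. \<xi> x * (a x * partial_deriv j \<psi> x - b x * partial_deriv i \<psi> x) \<partial>?M)
    = (\<integral>x. a x * (\<xi> x * partial_deriv j \<psi> x) - b x * (\<xi> x * partial_deriv i \<psi> x) \<partial>?M)"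
    by (simp add: algebra_simps)
  also have "\<dots> = (\<integral>x. a x * (\<xi> x * partial_deriv j \<psi> x) \<partial>?M) - (\<integral>x. b x * (\<xi> x * partial_deriv i \<psi> x) \<partial>?M)"
    by (intro Bochner_Integration.integral_diff L2_mult_integrable L L')
  also have "\<dots> = - (\<integral>x. a x * (\<xi>' x * \<psi> x) \<partial>?M)"
  proof -
    have "(\<integral>x. a x * partial_deriv j \<Psi> x \<partial>?M)
      = (\<integral>x. a x * (\<xi> x * partial_deriv j \<psi> x) + a x * (\<xi>' x * \<psi> x) \<partial>?M)"
      by (simp add: \<Psi>j algebra_simps)
    also have "\<dots> = (\<integral>x. a x * (\<xi> x * partial_deriv j \<psi> x) \<partial>?M) + (\<integral>x. a x * (\<xi>' x * \<psi> x) \<partial>?M)"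
      by (intro Bochner_Integration.integral_add L2_mult_integrable L L')
    finally show ?thesis using eq by (simp add: \<Psi>i)
  qed
  finally show ?thesis by (simp add: \<xi>_def \<xi>'_def j_def)
qed

text \<open>Two limits remain after \<open>integral_jacobian_cutoff\<close>, and their order
  matters. At fixed \<open>N\<close> the limit along \<open>\<psi>\<close> removes the boundary
  values together with the constant \<open>K\<close>; the limit in \<open>N\<close> then removes the
  Hardy term, whose factor is \<open>8 / harm N\<close>.\<close>

lemma integral_jacobian_zero:
  assumes \<phi>: "\<And>n. smooth (\<phi> n)" and \<psi>: "\<And>n. smooth (\<psi> n)"
    and a: "tendsto_L2 (lebesgue_on square) (\<lambda>n. partial_deriv i (\<phi> n)) a"
    and b: "tendsto_L2 (lebesgue_on square) (\<lambda>n. partial_deriv (i + 1) (\<phi> n)) b"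
    and c: "tendsto_L2 (lebesgue_on square) (\<lambda>n. partial_deriv i (\<psi> n)) c"
    and d: "tendsto_L2 (lebesgue_on square) (\<lambda>n. partial_deriv (i + 1) (\<psi> n)) d"
    and \<phi>0: "\<And>s. s \<in> {-1, 1} \<Longrightarrow>
      (\<lambda>n. integral {-1..1} (\<lambda>r. (\<phi> n (side_point ((i, s), r)))\<^sup>2)) \<longlonglongrightarrow> 0"
    and \<psi>0: "\<And>s. s \<in> {-1, 1} \<Longrightarrow>
      (\<lambda>n. integral {-1..1} (\<lambda>r. (\<psi> n (side_point ((i + 1, s), r)))\<^sup>2)) \<longlonglongrightarrow> 0"
  shows "(\<integral>x. a x * d x \<partial>lebesgue_on square) = (\<integral>x. b x * c x \<partial>lebesgue_on square)"
proof -
  let ?M = "lebesgue_on square"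
  define j where "j = i + 1"
  note d = d[folded j_def] and b = b[folded j_def]
  define \<xi> where "\<xi> N = (\<lambda>x::real^2. cutoff N (x $ j))" for N
  define \<xi>' where "\<xi>' N = (\<lambda>x::real^2. cutoff_deriv N (x $ j))" for N
  have L: "a \<in> L2 ?M" "b \<in> L2 ?M" "c \<in> L2 ?M" "d \<in> L2 ?M"
    using a b c d by (auto simp: tendsto_L2_def)
  have \<xi>c: "continuous_on UNIV (\<xi> N)" "continuous_on UNIV (\<xi>' N)" for N
    unfolding \<xi>_def \<xi>'_def
    by (rule continuous_on_cutoff_coord)+
  define A where "A = (\<integral>x. (a x)\<^sup>2 \<partial>?M)"
  have A: "0 \<le> A" by (simp add: A_def)
  have key: "(\<integral>x. \<xi> N x * (a x * d x - b x * c x) \<partial>?M)\<^sup>2 \<le> A * (2 * (8 / harm N) * (\<integral>x. (d x)\<^sup>2 \<partial>?M))"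
    if N: "0 < N" for N
  proof -
    obtain K where K: "\<And>t. t \<in> {-1..1} \<Longrightarrow> (cutoff_deriv N t)\<^sup>2 \<le> K"
      using cutoff_deriv_bounded[of N] by blast
    define B where "B m = integral {-1..1} (\<lambda>t. (\<psi> m (side_point ((j, 1), t)))\<^sup>2)
      + integral {-1..1} (\<lambda>t. (\<psi> m (side_point ((j, -1), t)))\<^sup>2)" for m
    have "B \<longlonglongrightarrow> 0 + 0"
      unfolding B_def[abs_def] j_def by (intro tendsto_add \<psi>0) auto
    then have B0: "B \<longlonglongrightarrow> 0" by simp
    define X where "X m = (\<integral>x. partial_deriv j (\<psi> m) x * (\<xi> N x * a x) \<partial>?M)
        - (\<integral>x. partial_deriv i (\<psi> m) x * (\<xi> N x * b x) \<partial>?M)" for m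
    note L' = L2_mult_continuous[OF L(1) \<xi>c(1)] L2_mult_continuous[OF L(2) \<xi>c(1)]
    have X: "X \<longlonglongrightarrow> (\<integral>x. d x * (\<xi> N x * a x) \<partial>?M) - (\<integral>x. c x * (\<xi> N x * b x) \<partial>?M)"
      unfolding X_def[abs_def] by (intro tendsto_diff tendsto_L2_integral_mult[OF d] tendsto_L2_integral_mult[OF c] L')
    \<comment> \<open>Cauchy-Schwarz splits off the fixed function \<open>a\<close>. The other
      factor falls under \<open>weighted_hardy_square\<close> with weight
      \<open>(cutoff_deriv N)\<^sup>2\<close>, for which \<open>V\<close> is
      \<open>8 / harm N\<close>.\<close>
    have bound: "(X m)\<^sup>2 \<le> A * (4 * K * B m + 2 * (8 / harm N) * (\<integral>x. (partial_deriv j (\<psi> m) x)\<^sup>2 \<partial>?M))" for m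
    proof -
      have Lm: "partial_deriv k (\<psi> m) \<in> L2 ?M" for k by (intro smooth_L2 smooth_partial_deriv \<psi>)
      have "X m = (\<integral>x. partial_deriv j (\<psi> m) x * (\<xi> N x * a x) - partial_deriv i (\<psi> m) x * (\<xi> N x * b x) \<partial>?M)"
        unfolding X_def by (intro Bochner_Integration.integral_diff[symmetric] L2_mult_integrable Lm L')
      also have "\<dots> = (\<integral>x. \<xi> N x * (a x * partial_deriv j (\<psi> m) x - b x * partial_deriv i (\<psi> m) x) \<partial>?M)"
        by (simp add: algebra_simps)
      also have "\<dots> = - (\<integral>x. a x * (\<xi>' N x * \<psi> m x) \<partial>?M)"
        unfolding \<xi>_def \<xi>'_def j_def
        by (rule integral_jacobian_cutoff[OF \<phi> \<psi> N a b[unfolded j_def] \<phi>0])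
      finally have "(X m)\<^sup>2 = (\<integral>x. a x * (\<xi>' N x * \<psi> m x) \<partial>?M)\<^sup>2" by simp
      also have "\<dots> \<le> A * (\<integral>x. (\<xi>' N x * \<psi> m x)\<^sup>2 \<partial>?M)"
        unfolding A_def by (intro L2_Cauchy_Schwarz L L2_mult_continuous smooth_L2 \<psi> \<xi>c)
      also have "(\<integral>x. (\<xi>' N x * \<psi> m x)\<^sup>2 \<partial>?M) = (\<integral>x. (cutoff_deriv N (x $ j))\<^sup>2 * (\<psi> m x)\<^sup>2 \<partial>?M)"
        by (simp add: \<xi>'_def power_mult_distrib)
      also have "A * \<dots> \<le> A * (4 * K * B m + 2 * (8 / harm N) * (\<integral>x. (partial_deriv j (\<psi> m) x)\<^sup>2 \<partial>?M))"
        unfolding B_def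
        by (intro mult_left_mono[OF _ A] weighted_hardy_square \<psi> cutoff_deriv_integral K continuous_intros cutoff_continuous_on)
           auto
      finally show ?thesis .
    qed
    have "((\<integral>x. d x * (\<xi> N x * a x) \<partial>?M) - (\<integral>x. c x * (\<xi> N x * b x) \<partial>?M))\<^sup>2
      \<le> A * (4 * K * 0 + 2 * (8 / harm N) * (\<integral>x. (d x)\<^sup>2 \<partial>?M))"
    proof (rule LIMSEQ_le[OF tendsto_power[OF X]])
      show "(\<lambda>m. A * (4 * K * B m + 2 * (8 / harm N) * (\<integral>x. (partial_deriv j (\<psi> m) x)\<^sup>2 \<partial>?M)))
        \<longlonglongrightarrow> A * (4 * K * 0 + 2 * (8 / harm N) * (\<integral>x. (d x)\<^sup>2 \<partial>?M))"
        by (intro tendsto_intros B0 tendsto_L2_norm d)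
    qed (use bound in blast)
    moreover have "(\<integral>x. d x * (\<xi> N x * a x) \<partial>?M) - (\<integral>x. c x * (\<xi> N x * b x) \<partial>?M)
      = (\<integral>x. \<xi> N x * (a x * d x - b x * c x) \<partial>?M)"
      by (subst Bochner_Integration.integral_diff[symmetric]; (intro L2_mult_integrable L L')?)
         (simp add: algebra_simps)
    ultimately show ?thesis by simp
  qed
  have int: "integrable ?M (\<lambda>x. a x * d x - b x * c x)"
    by (intro Bochner_Integration.integrable_diff L2_mult_integrable L)
  have lim: "(\<lambda>N. \<integral>x. \<xi> N x * (a x * d x - b x * c x) \<partial>?M) \<longlonglongrightarrow> (\<integral>x. a x * d x - b x * c x \<partial>?M)"
  proof -
    \<comment> \<open>The shift by one provides the assumption \<open>0 < N\<close> of
      \<open>cutoff_bounds\<close>, which gives the dominating function;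
      \<open>LIMSEQ_imp_Suc\<close> undoes it.\<close>
    have "(\<lambda>N. \<integral>x. \<xi> (Suc N) x * (a x * d x - b x * c x) \<partial>?M) \<longlonglongrightarrow> (\<integral>x. a x * d x - b x * c x \<partial>?M)"
    proof (rule integral_dominated_convergence[where w="\<lambda>x. \<bar>a x * d x - b x * c x\<bar>"])
      show "AE x in ?M. (\<lambda>N. \<xi> (Suc N) x * (a x * d x - b x * c x)) \<longlonglongrightarrow> a x * d x - b x * c x"
        using AE_interior_square
      proof eventually_elim
        case (elim x)
        then have "\<bar>x $ j\<bar> < 1" by (auto simp: mem_box_cart abs_less_iff minus_less_iff)
        from LIMSEQ_Suc[OF cutoff_tendsto[OF this]]
        have "(\<lambda>N. \<xi> (Suc N) x * (a x * d x - b x * c x)) \<longlonglongrightarrow> 1 * (a x * d x - b x * c x)"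
          unfolding \<xi>_def by (intro tendsto_intros)
        then show ?case by simp
      qed
      show "AE x in ?M. norm (\<xi> (Suc N) x * (a x * d x - b x * c x)) \<le> \<bar>a x * d x - b x * c x\<bar>" for N
        using AE_space
      proof eventually_elim
        case (elim x)
        then have "\<bar>x $ j\<bar> \<le> 1"
          by (auto simp: space_lebesgue_square square_def mem_box_cart abs_le_iff minus_le_iff)
        from mult_right_mono[OF cutoff_bounds[OF _ this, of "Suc N"], of "\<bar>a x * d x - b x * c x\<bar>"]
        show ?case by (simp add: \<xi>_def abs_mult)
      qed
      have "\<xi> N \<in> borel_measurable ?M" for N
        by (intro measurable_restrict_space1 measurable_completion)
           (simp add: borel_measurable_continuous_onI[OF \<xi>c(1)])
      then show "(\<lambda>x. \<xi> (Suc N) x * (a x * d x - b x * c x)) \<in> borel_measurable ?M" for N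
        using borel_measurable_integrable[OF int] by (intro borel_measurable_times)
    qed (use int in auto)
    then show ?thesis by (rule LIMSEQ_imp_Suc)
  qed
  have "(\<integral>x. a x * d x - b x * c x \<partial>?M)\<^sup>2 \<le> 0"
  proof (rule LIMSEQ_le[OF tendsto_power[OF lim]])
    show "(\<lambda>N. A * (2 * (\<integral>x. (d x)\<^sup>2 \<partial>?M)) * (8 / harm N)) \<longlonglongrightarrow> 0"
      using tendsto_mult_left[OF harm_inverse_tendsto] by auto
    show "\<exists>N. \<forall>n\<ge>N. (\<integral>x. \<xi> n x * (a x * d x - b x * c x) \<partial>?M)\<^sup>2 \<le> A * (2 * (\<integral>x. (d x)\<^sup>2 \<partial>?M)) * (8 / harm n)"
      using key by (intro exI[of _ 1]) (auto simp: mult_ac)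
  qed
  then have "(\<integral>x. a x * d x - b x * c x \<partial>?M) = 0" by simp
  then show ?thesis by (simp add: Bochner_Integration.integral_diff L2_mult_integrable L)
qed

section \<open>Symmetry of the weak Hessian\<close>

lemma compact_closed_subset:
  fixes S :: "'a::t2_space set"
  shows "compact S \<Longrightarrow> closed T \<Longrightarrow> T \<subseteq> S \<Longrightarrow> compact T"
  using compact_Int_closed[of S T] by (simp add: Int_absorb1)

lemma test_functions_support:
  assumes \<rho>: "\<rho> \<in> test_functions U" and f: "smooth f" and z: "\<And>x. x \<notin> closure {x. \<rho> x \<noteq> 0} \<Longrightarrow> f x = 0"
  shows "f \<in> test_functions U"
proof -
  have "closure {x. f x \<noteq> 0} \<subseteq> closure {x. \<rho> x \<noteq> 0}"
    using z by (intro closure_minimal) auto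
  with \<rho> f compact_closed_subset[OF _ closed_closure this] show ?thesis
    by (auto simp: test_functions_def)
qed

lemma test_functions_mult:
  assumes "\<rho> \<in> test_functions U" "smooth f"
  shows "(\<lambda>x. f x * \<rho> x) \<in> test_functions U"
proof (rule test_functions_support[OF assms(1)])
  show "f x * \<rho> x = 0" if "x \<notin> closure {x. \<rho> x \<noteq> 0}" for x
    using that closure_subset[of "{x. \<rho> x \<noteq> 0}"] by auto
qed (use assms in \<open>auto simp: test_functions_def intro: smooth_mult\<close>)

lemma test_functions_partial_deriv:
  assumes "\<rho> \<in> test_functions U"
  shows "partial_deriv i \<rho> \<in> test_functions U"
proof (rule test_functions_support[OF assms])
  let ?S = "closure {x. \<rho> x \<noteq> 0}"
  fix x assume x: "x \<notin> ?S"
  have "(\<rho> has_derivative (\<lambda>_. 0)) (at x)"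
    by (rule has_derivative_transform_within_open[OF has_derivative_const[of 0] open_Compl[OF closed_closure]])
       (use x closure_subset[of "{x. \<rho> x \<noteq> 0}"] in auto)
  then show "partial_deriv i \<rho> x = 0" by (rule partial_deriv_eqI)
qed (use assms in \<open>auto simp: test_functions_def intro: smooth_partial_deriv\<close>)

text \<open>Both derivatives are moved onto \<open>\<eta>\<close>, where they commute because
  \<open>\<eta>\<close> is smooth; the two signs cancel in each order.\<close>

lemma weak_partial_commute:
  assumes "has_weak_partial \<Omega> i u f" "has_weak_partial \<Omega> j f fj"
    and "has_weak_partial \<Omega> j u g" "has_weak_partial \<Omega> i g gi"
    and \<eta>: "\<eta> \<in> test_functions (interior \<Omega>)"
  shows "(\<integral>x. fj x * \<eta> x \<partial>lebesgue_on (interior \<Omega>)) = (\<integral>x. gi x * \<eta> x \<partial>lebesgue_on (interior \<Omega>))"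
proof -
  have "smooth \<eta>" using \<eta> by (simp add: test_functions_def)
  then have "partial_deriv i (partial_deriv j \<eta>) = partial_deriv j (partial_deriv i \<eta>)"
    by (intro ext smooth_partial_deriv_commute)
  moreover have "(\<integral>x. v x * partial_deriv k \<rho> x \<partial>lebesgue_on (interior \<Omega>))
      = - (\<integral>x. v' x * \<rho> x \<partial>lebesgue_on (interior \<Omega>))"
    if "has_weak_partial \<Omega> k v v'" "\<rho> \<in> test_functions (interior \<Omega>)" for k v v' \<rho>
    using that by (simp add: has_weak_partial_def)
  note this[OF assms(1) test_functions_partial_deriv[OF \<eta>, of j]] this[OF assms(2) \<eta>]
    this[OF assms(3) test_functions_partial_deriv[OF \<eta>, of i]] this[OF assms(4) \<eta>]
  ultimately show ?thesis by simp
qed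

text \<open>A product of flat functions of \<open>k - (k + 1) * x $ i\<close> and
  \<open>k + (k + 1) * x $ i\<close>. One of them is nonpositive as soon as
  \<open>\<bar>x $ i\<bar>\<close> reaches \<open>k / (k + 1)\<close>, which keeps the support
  compact inside the open cube. In the open cube both tend to infinity with \<open>k\<close>, where
  \<open>flat 0\<close> tends to 1.\<close>

definition bump :: "nat \<Rightarrow> real^'n::finite \<Rightarrow> real" where
  "bump k x = (\<Prod>i\<in>UNIV. flat 0 (real k + (- real (Suc k)) * x $ i) * flat 0 (real k + real (Suc k) * x $ i))"

lemma flat_0_bounds: "0 \<le> flat 0 t" "flat 0 t \<le> 1"
  by (auto simp: flat_def)

lemma bump_bounds: "0 \<le> bump k x" "bump k x \<le> 1"
  unfolding bump_def
  by (auto intro!: prod_nonneg prod_le_1 mult_nonneg_nonneg mult_le_one flat_0_bounds)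

lemma smooth_bump: "smooth (bump k)"
  unfolding bump_def[abs_def] by (intro smooth_prod smooth_mult smooth_flat)

lemma bump_test_function: "bump k \<in> test_functions (box (-1) 1 :: (real^'n::finite) set)"
proof -
  define r where "r = real k / real (Suc k)"
  have r: "r < 1" by (simp add: r_def)
  let ?C = "cbox (\<chi> i. - r) (\<chi> i. r) :: (real^'n) set"
  have "x \<in> ?C" if "bump k x \<noteq> 0" for x :: "real^'n"
  proof -
    have "- r \<le> x $ i \<and> x $ i \<le> r" for i
    proof -
      have "flat 0 (real k + (- real (Suc k)) * x $ i) \<noteq> 0" "flat 0 (real k + real (Suc k) * x $ i) \<noteq> 0"
        using that by (auto simp: bump_def)
      then have "0 < real k + (- real (Suc k)) * x $ i" "0 < real k + real (Suc k) * x $ i"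
        by (auto simp: flat_def split: if_splits)
      then show ?thesis by (simp add: r_def field_simps)
    qed
    then show ?thesis by (simp add: mem_box_cart)
  qed
  then have sub: "closure {x. bump k x \<noteq> 0} \<subseteq> ?C" by (intro closure_minimal) auto
  moreover have "?C \<subseteq> box (-1) 1"
  proof
    fix x assume "x \<in> ?C"
    then have "- 1 < x $ i \<and> x $ i < 1" for i
      using r by (auto simp: mem_box_cart dest!: spec[of _ i])
    then show "x \<in> box (-1) 1" by (simp add: mem_box_cart)
  qed
  moreover have "compact (closure {x::real^'n. bump k x \<noteq> 0})"
    by (rule compact_closed_subset[OF compact_cbox closed_closure sub])
  ultimately show ?thesis by (auto simp: test_functions_def smooth_bump)
qed

lemma flat_0_tendsto:
  assumes "\<bar>y\<bar> < 1"
  shows "(\<lambda>k. flat 0 (real k + real (Suc k) * y)) \<longlonglongrightarrow> 1"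
proof -
  have "filterlim (\<lambda>k. y + (1 + y) * real k) at_top sequentially"
    using assms by (intro filterlim_tendsto_add_at_top[OF tendsto_const]
        filterlim_tendsto_pos_mult_at_top[OF tendsto_const] filterlim_real_sequentially) auto
  then have lim: "filterlim (\<lambda>k. real k + real (Suc k) * y) at_top sequentially"
    by (simp add: algebra_simps)
  have "((\<lambda>t::real. exp (- (1 / t))) \<longlongrightarrow> exp (- 0)) at_top"
    by (intro tendsto_intros tendsto_divide_0[OF tendsto_const] filterlim_at_top_imp_at_infinity filterlim_ident)
  moreover have "\<forall>\<^sub>F t in at_top. exp (- (1 / t)) = flat 0 t"
    using eventually_gt_at_top[of 0] by eventually_elim (simp add: flat_def)
  ultimately have "(flat 0 \<longlongrightarrow> 1) at_top" using tendsto_cong by fastforce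
  from filterlim_compose[OF this lim] show ?thesis .
qed

lemma bump_tendsto:
  assumes "x \<in> box (-1) 1" shows "(\<lambda>k. bump k x) \<longlonglongrightarrow> 1"
proof -
  have x: "\<bar>x $ i\<bar> < 1" for i using assms by (auto simp: mem_box_cart abs_less_iff minus_less_iff)
  have "(\<lambda>k. bump k x) \<longlonglongrightarrow> (\<Prod>i\<in>(UNIV::'a set). 1 * 1)"
    unfolding bump_def
  proof (intro tendsto_prod tendsto_mult)
    show "(\<lambda>k. flat 0 (real k + (- real (Suc k)) * x $ i)) \<longlonglongrightarrow> 1" for i
      using flat_0_tendsto[of "- (x $ i)"] x[of i]
      by (simp add: algebra_simps)
  qed (rule flat_0_tendsto[OF x])
  then show ?thesis by simp
qed

lemma interior_square: "interior square = box (-1) 1"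
  by (simp add: square_def)

text \<open>Weak derivatives are tested on the interior, but norms and traces refer to the closed
  square; a test function is 0 on the difference.\<close>

lemma integral_interior_square:
  assumes "\<eta> \<in> test_functions (box (-1) 1)"
  shows "(\<integral>x. h x * \<eta> x \<partial>lebesgue_on (interior square)) = (\<integral>x. h x * \<eta> x \<partial>lebesgue_on square)"
proof -
  have "\<eta> x = 0" if "x \<notin> box (-1) 1" for x
    using assms that closure_subset[of "{x. \<eta> x \<noteq> 0}"] by (auto simp: test_functions_def)
  then have *: "indicator (box (-1) 1) x *\<^sub>R (h x * \<eta> x) = indicator square x *\<^sub>R (h x * \<eta> x)" for x
    using box_subset_cbox[of "-1" "1::real^2"] by (auto simp: indicator_def square_def)
  then show ?thesis
    by (simp add: interior_square integral_restrict_space square_def *[unfolded square_def]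
        del: real_scaleR_def scaleR_eq_iff)
qed

text \<open>Smooth functions approximating \<open>h\<close> replace the fundamental lemma of the calculus of
  variations: multiplied by \<open>bump k\<close> they become test functions.\<close>

lemma L2_norm_zero_if_orthogonal_to_test_functions:
  assumes \<theta>: "\<And>n. smooth (\<theta> n)" and lim: "tendsto_L2 (lebesgue_on square) \<theta> h"
    and orth: "\<And>\<eta>. \<eta> \<in> test_functions (box (-1) 1) \<Longrightarrow> (\<integral>x. h x * \<eta> x \<partial>lebesgue_on square) = 0"
  shows "(\<integral>x. (h x)\<^sup>2 \<partial>lebesgue_on square) = 0"
proof -
  let ?M = "lebesgue_on square"
  have L: "h \<in> L2 ?M" using lim by (simp add: tendsto_L2_def)
  have "(\<integral>x. \<theta> n x * h x \<partial>?M) = 0" for n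
  proof -
    have int: "integrable ?M (\<lambda>x. \<theta> n x * h x)"
      by (intro L2_mult_integrable smooth_L2 \<theta> L)
    \<comment> \<open>For each \<open>k\<close> the product of \<open>bump k\<close> and
      \<open>\<theta> n\<close> is a test function, so this sequence is constantly 0; dominated
      convergence removes the bump.\<close>
    have "(\<lambda>k. \<integral>x. bump k x * (\<theta> n x * h x) \<partial>?M) \<longlonglongrightarrow> (\<integral>x. \<theta> n x * h x \<partial>?M)"
    proof (rule integral_dominated_convergence[where w="\<lambda>x. \<bar>\<theta> n x * h x\<bar>"])
      show "AE x in ?M. (\<lambda>k. bump k x * (\<theta> n x * h x)) \<longlonglongrightarrow> \<theta> n x * h x"
        using AE_interior_square
      proof eventually_elim
        case (elim x)
        from tendsto_mult_right[OF bump_tendsto[OF this], of "\<theta> n x * h x"] show ?case by simp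
      qed
      have "\<bar>bump k x * y\<bar> \<le> \<bar>y\<bar>" for k x y
        using mult_right_mono[OF bump_bounds(2)[of k x] abs_ge_zero[of y]] bump_bounds(1)[of k x]
        by (simp add: abs_mult)
      then show "AE x in ?M. norm (bump k x * (\<theta> n x * h x)) \<le> \<bar>\<theta> n x * h x\<bar>" for k
        by (intro AE_I2) (simp only: real_norm_def)
      show "(\<lambda>x. bump k x * (\<theta> n x * h x)) \<in> borel_measurable ?M" for k
        using smooth_L2[OF smooth_bump[of k]] smooth_L2[OF \<theta>[of n]] L
        by (intro borel_measurable_times) (auto simp: L2_def)
    qed (use int in auto)
    moreover have "(\<integral>x. bump k x * (\<theta> n x * h x) \<partial>?M) = 0" for k
      using orth[OF test_functions_mult[OF bump_test_function[of k] \<theta>[of n]]] by (simp add: mult_ac)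
    ultimately show ?thesis by (simp add: LIMSEQ_const_iff)
  qed
  \<comment> \<open>Pairing the sequence with its own limit \<open>h\<close> turns orthogonality to
    every \<open>\<theta> n\<close> into a vanishing norm.\<close>
  with tendsto_L2_integral_mult[OF lim L] show ?thesis
    by (simp add: LIMSEQ_const_iff power2_eq_square)
qed

lemma tendsto_L2_diff:
  assumes f: "tendsto_L2 M f F" and g: "tendsto_L2 M g G"
  shows "tendsto_L2 M (\<lambda>n x. f n x - g n x) (\<lambda>x. F x - G x)"
proof -
  have L: "f n \<in> L2 M" "F \<in> L2 M" "g n \<in> L2 M" "G \<in> L2 M" for n
    using f g by (auto simp: tendsto_L2_def)
  note int = L2_integrable_power2[OF L2_diff[OF L(1,2)]] L2_integrable_power2[OF L2_diff[OF L(3,4)]]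
  have "(\<lambda>n. \<integral>x. ((f n x - g n x) - (F x - G x))\<^sup>2 \<partial>M) \<longlonglongrightarrow> 0"
  proof (rule tendsto_sandwich[OF _ _ tendsto_const])
    have "(\<integral>x. ((f n x - g n x) - (F x - G x))\<^sup>2 \<partial>M)
      \<le> (\<integral>x. 2 * (f n x - F x)\<^sup>2 + 2 * (g n x - G x)\<^sup>2 \<partial>M)" for n
    proof (rule integral_mono)
      show "integrable M (\<lambda>x. ((f n x - g n x) - (F x - G x))\<^sup>2)"
        by (intro L2_integrable_power2 L2_diff L)
      show "((f n x - g n x) - (F x - G x))\<^sup>2 \<le> 2 * (f n x - F x)\<^sup>2 + 2 * (g n x - G x)\<^sup>2" for x
        using sum_squares_ge_zero[of "(f n x - F x) + (g n x - G x)" 0]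
        by (simp add: power2_eq_square algebra_simps)
    qed (simp add: int)
    then show "\<forall>\<^sub>F n in sequentially. (\<integral>x. ((f n x - g n x) - (F x - G x))\<^sup>2 \<partial>M)
      \<le> 2 * (\<integral>x. (f n x - F x)\<^sup>2 \<partial>M) + 2 * (\<integral>x. (g n x - G x)\<^sup>2 \<partial>M)"
      by (simp add: int)
    have "(\<lambda>n. 2 * (\<integral>x. (f n x - F x)\<^sup>2 \<partial>M) + 2 * (\<integral>x. (g n x - G x)\<^sup>2 \<partial>M)) \<longlonglongrightarrow> 2 * 0 + 2 * 0"
      using f g by (intro tendsto_intros) (auto simp: tendsto_L2_def)
    then show "(\<lambda>n. 2 * (\<integral>x. (f n x - F x)\<^sup>2 \<partial>M) + 2 * (\<integral>x. (g n x - G x)\<^sup>2 \<partial>M)) \<longlonglongrightarrow> 0" by simp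
  qed simp
  then show ?thesis unfolding tendsto_L2_def by (auto intro: L2_diff L)
qed

text \<open>Membership in \<open>sobolev\<close> supplies the existence that makes the choice in
  \<open>weak_partial\<close> a genuine weak derivative. It says nothing further about the
  representative chosen.\<close>

lemma sobolev_Suc_weak_partial:
  assumes "u \<in> sobolev (Suc k) \<Omega>"
  shows "has_weak_partial \<Omega> i u (weak_partial \<Omega> i u)"
proof -
  from assms obtain g where "has_weak_partial \<Omega> i u g" by auto
  then show ?thesis unfolding weak_partial_def by (rule someI[where P="has_weak_partial \<Omega> i u"])
qed

theorem theorem4p4:
  fixes u :: "real^2 \<Rightarrow> real"
  assumes "u \<in> X2"
  shows "R2 u = R3 u"
proof -
  let ?M = "lebesgue_on square"
  define w where "w i j = weak_partial square j (weak_partial square i u)" for i j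
  from assms obtain t where u: "u \<in> sobolev 2 square"
    and tr: "\<And>i. has_trace square square_boundary_measure (weak_partial square i u) (t i)"
    and zero: "AE x in square_boundary_measure. (\<Sum>i\<in>UNIV. square_normal x $ i * t i x) = 0"
    unfolding X2_def has_normal_derivative_def by auto
  have "\<forall>i. \<exists>\<phi>. (\<forall>n. smooth (\<phi> n)) \<and>
      (\<forall>j. tendsto_L2 ?M (\<lambda>n. partial_deriv j (\<phi> n)) (w i j)) \<and>
      tendsto_L2 square_boundary_measure \<phi> (t i)"
    using tr unfolding has_trace_def w_def by blast
  then obtain \<phi> where \<phi>: "\<And>i n. smooth (\<phi> i n)"
    and w: "\<And>i j. tendsto_L2 ?M (\<lambda>n. partial_deriv j (\<phi> i n)) (w i j)"
    and bd: "\<And>i. tendsto_L2 square_boundary_measure (\<phi> i) (t i)"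
    by metis
  have L: "w i j \<in> L2 ?M" for i j using w[of j i] by (simp add: tendsto_L2_def)
  have side: "(\<lambda>n. integral {-1..1} (\<lambda>r. (\<phi> i n (side_point ((i, s), r)))\<^sup>2)) \<longlonglongrightarrow> 0"
    if "s \<in> {-1, 1}" for i s
    by (rule trace_vanishes_on_side[OF \<phi> bd zero that])
  \<comment> \<open>Here \<open>\<phi> 1\<close> tends to 0 on the sides orthogonal to direction 1
    and \<open>\<phi> 2\<close> on those orthogonal to direction 2, which are the two boundary
    hypotheses for \<open>i = 1\<close>.\<close>
  have det: "(\<integral>x. w 1 1 x * w 2 2 x \<partial>?M) = (\<integral>x. w 1 2 x * w 2 1 x \<partial>?M)"
    by (rule integral_jacobian_zero[of "\<phi> 1" "\<phi> 2" 1, unfolded one_add_one, OF \<phi> \<phi> w w w w side side])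
  have sym: "(\<integral>x. (w 1 2 x - w 2 1 x)\<^sup>2 \<partial>?M) = 0"
  proof (rule L2_norm_zero_if_orthogonal_to_test_functions)
    \<comment> \<open>The approximations that come with the traces are reused: their derivatives
      form the smooth sequence tending to \<open>w 1 2 - w 2 1\<close>.\<close>
    show "smooth (\<lambda>x. partial_deriv 2 (\<phi> 1 n) x - partial_deriv 1 (\<phi> 2 n) x)" for n
      by (intro smooth_diff smooth_partial_deriv \<phi>)
    show "tendsto_L2 ?M (\<lambda>n x. partial_deriv 2 (\<phi> 1 n) x - partial_deriv 1 (\<phi> 2 n) x) (\<lambda>x. w 1 2 x - w 2 1 x)"
      by (intro tendsto_L2_diff w)
  next
    fix \<eta> :: "real^2 \<Rightarrow> real" assume \<eta>: "\<eta> \<in> test_functions (box (-1) 1)"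
    have 1: "has_weak_partial square i u (weak_partial square i u)" for i
      using u sobolev_Suc_weak_partial[of u 1 square] by (simp add: numeral_2_eq_2)
    \<comment> \<open>That the chosen first derivative lies in \<open>sobolev 1\<close> is read off
      from \<open>has_trace\<close>; membership of \<open>u\<close> in \<open>sobolev 2\<close>
      provides this for some weak derivative only.\<close>
    have 2: "has_weak_partial square j (weak_partial square i u) (w i j)" for i j
      using tr sobolev_Suc_weak_partial[of _ 0 square] by (simp add: has_trace_def w_def)
    have "(\<integral>x. w 1 2 x * \<eta> x \<partial>?M) = (\<integral>x. w 2 1 x * \<eta> x \<partial>?M)"
      using weak_partial_commute[OF 1[of 1] 2[of 2 1] 1[of 2] 2[of 1 2]] \<eta>
      by (simp add: integral_interior_square interior_square[symmetric])
    moreover have "\<eta> \<in> L2 ?M" using \<eta> by (intro smooth_L2) (simp add: test_functions_def)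
    ultimately show "(\<integral>x. (w 1 2 x - w 2 1 x) * \<eta> x \<partial>?M) = 0"
      by (simp add: left_diff_distrib L2_mult_integrable L)
  qed
  have "(\<integral>x. \<bar>laplacian square u x\<bar>\<^sup>2 \<partial>?M) = (\<integral>x. (w 1 1 x)\<^sup>2 + (w 2 2 x)\<^sup>2 + 2 * (w 1 1 x * w 2 2 x) \<partial>?M)"
    by (simp add: laplacian_def w_def sum_2 power2_sum mult.assoc)
  also have "\<dots> = (\<integral>x. (w 1 1 x)\<^sup>2 \<partial>?M) + (\<integral>x. (w 2 2 x)\<^sup>2 \<partial>?M) + 2 * (\<integral>x. w 1 2 x * w 2 1 x \<partial>?M)"
    by (simp add: L2_integrable_power2 L2_mult_integrable L det)
  \<comment> \<open>Adding this zero integral turns \<open>2 * (w 1 2 x * w 2 1 x)\<close> into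
    \<open>(w 1 2 x)\<^sup>2 + (w 2 1 x)\<^sup>2\<close>, so the Frobenius norm is reached by a
    pointwise identity.\<close>
  also have "\<dots> = (\<integral>x. (w 1 1 x)\<^sup>2 \<partial>?M) + (\<integral>x. (w 2 2 x)\<^sup>2 \<partial>?M) + 2 * (\<integral>x. w 1 2 x * w 2 1 x \<partial>?M)
      + (\<integral>x. (w 1 2 x - w 2 1 x)\<^sup>2 \<partial>?M)"
    by (simp add: sym)
  also have "\<dots> = (\<integral>x. (w 1 1 x)\<^sup>2 + (w 2 2 x)\<^sup>2 + 2 * (w 1 2 x * w 2 1 x) + (w 1 2 x - w 2 1 x)\<^sup>2 \<partial>?M)"
    by (simp add: L2_integrable_power2 L2_mult_integrable L2_diff L)
  also have "\<dots> = (\<integral>x. (norm (hessian square u x))\<^sup>2 \<partial>?M)"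
    unfolding power2_norm_eq_inner
    by (simp add: inner_vec_def hessian_def w_def[symmetric] sum_2 power2_eq_square algebra_simps)
  finally show ?thesis by (simp add: R2_def R3_def)
qed

end
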